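(* Let $\mathbb{G}$ be a homogeneous group of homogeneous dimension $Q$, let $|\cdot|$ be any homogeneous quasi-norm on $\mathbb{G}$, and let $2\le p<Q$. Then there exists a constant $C>0$ such that for all real-valued functions $u\in C_0^\infty(\mathbb{G})$ we have $$\int_{\mathbb{G}}|\mathcal{R}u|^p\,dx-\left(\frac{Q-p}{p}\right)^p\int_{\mathbb{G}}\frac{|u|^p}{|x|^p}\,dx\ \ge\ C\,\sup_{R>0}d_H(u;R)^p,$$ where $\mathcal{R}=\frac{d}{d|x|}$ is the radial derivative and, for $R>0$, $$d_H(u;R):=\left(\int_{\mathbb{G}}\frac{\left|u(x)-R^{\frac{Q-p}{p}}\,u\!\left(R\frac{x}{|x|}\right)|x|^{-\frac{Q-p}{p}}\right|^p}{|x|^p\left|\log\frac{R}{|x|}\right|^p}\,dx\right)^{1/p}.$$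
   Context: A homogeneous group $\mathbb{G}$ is a connected, simply connected Lie group whose Lie algebra $\mathfrak{g}$ is equipped with a family of dilations $D_\lambda=\mathrm{Exp}(A\ln\lambda)=\sum_{k\ge 0}\frac{1}{k!}(\ln(\lambda)A)^k$, $\lambda>0$, where $A$ is a diagonalisable positive linear operator on $\mathfrak{g}$ and each $D_\lambda$ is a morphism of the Lie algebra: $[D_\lambda X,D_\lambda Y]=D_\lambda[X,Y]$. The number $Q:=\mathrm{Tr}\,A$ is the homogeneous dimension of $\mathbb{G}$. Via the exponential map $\mathbb{G}$ is identified with $\mathfrak{g}\cong\mathbb{R}^n$, the dilations act on $\mathbb{G}$, and $dx$ is the Haar measure, which is Lebesgue measure on $\mathbb{R}^n$. For $r>0$ and $y\in\mathbb{G}$, $ry$ denotes the dilated point $D_r(y)$; thus for $x\ne 0$, $\frac{x}{|x|}=D_{1/|x|}(x)$ and $R\frac{x}{|x|}=D_{R/|x|}(x)$. A homogeneous quasi-norm is a continuous function $|\cdot|:\mathbb{G}\to[0,\infty)$ with $|x^{-1}|=|x|$, $|D_\lambda x|=\lambda|x|$ for $\lambda>0$, and $|x|=0$ if and only if $x=0$ (the identity element). The radial derivative is $\mathcal{R}f(x)=\frac{d}{d|x|}f(x)$, i.e. writing $x=ry$ with $r=|x|$ and $|y|=1$, $\mathcal{R}f(x)=\frac{\partial}{\partial r}f(ry)$. $C_0^\infty(\mathbb{G})$ denotes smooth compactly supported functions. *)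

theory Defs
  imports "HOL-Analysis.Analysis"
begin

primrec C_diff :: "nat \<Rightarrow> ('a::euclidean_space \<Rightarrow> 'b::real_normed_vector) \<Rightarrow> bool" where
  "C_diff 0 f \<longleftrightarrow> continuous_on UNIV f"
| "C_diff (Suc k) f \<longleftrightarrow>
     (\<forall>x. f differentiable (at x)) \<and> (\<forall>v. C_diff k (\<lambda>x. frechet_derivative f (at x) v))"

definition smooth :: "('a::euclidean_space \<Rightarrow> 'b::real_normed_vector) \<Rightarrow> bool" where
  "smooth f \<longleftrightarrow> (\<forall>k. C_diff k f)"

definition test_function :: "('a::euclidean_space \<Rightarrow> real) \<Rightarrow> bool" where
  "test_function u \<longleftrightarrow> smooth u \<and> compact (closure {x. u x \<noteq> 0})"

locale lie_algebra =
  fixes bracket :: "'a::real_vector \<Rightarrow> 'a \<Rightarrow> 'a"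
  assumes bilinear: "bilinear bracket"
    and alternating: "bracket x x = 0"
    and jacobi: "bracket x (bracket y z) + bracket y (bracket z x) + bracket z (bracket x y) = 0"

definition left_invariant_field ::
  "('a::real_normed_vector \<Rightarrow> 'a \<Rightarrow> 'a) \<Rightarrow> 'a \<Rightarrow> 'a \<Rightarrow> 'a" where
  "left_invariant_field gmul v x = frechet_derivative (\<lambda>y. gmul x y) (at 0) v"

definition field_bracket ::
  "('a::real_normed_vector \<Rightarrow> 'a) \<Rightarrow> ('a \<Rightarrow> 'a) \<Rightarrow> 'a \<Rightarrow> 'a" where
  "field_bracket X Y x = frechet_derivative Y (at x) (X x) - frechet_derivative X (at x) (Y x)"

text \<open>
  A connected, simply connected Lie group whose exponential map is a global chart, written in that
  chart: the underlying manifold is the Lie algebra itself and the identity element is \<open>0\<close>.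
  The assumption \<open>one_parameter\<close> says that the lines through \<open>0\<close> are the one-parameter
  subgroups, i.e. that the exponential map is the identity in these coordinates;
  \<open>lie_algebra_of_group\<close> says that \<open>bracket\<close> is the Lie bracket of the group, computed on
  left-invariant vector fields. These determine \<open>gmul\<close> uniquely from \<open>bracket\<close>
  (it is the Baker-Campbell-Hausdorff product).
\<close>

locale exponential_lie_group =
  lie_algebra bracket + group gmul 0 ginv
  for bracket :: "'a::euclidean_space \<Rightarrow> 'a \<Rightarrow> 'a"
    and gmul :: "'a \<Rightarrow> 'a \<Rightarrow> 'a"
    and ginv :: "'a \<Rightarrow> 'a" +
  assumes smooth_gmul: "smooth (\<lambda>(x, y). gmul x y)"
    and smooth_ginv: "smooth ginv"
    and one_parameter: "gmul (s *\<^sub>R v) (t *\<^sub>R v) = (s + t) *\<^sub>R v"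
    and lie_algebra_of_group:
      "field_bracket (left_invariant_field gmul v) (left_invariant_field gmul w) =
         left_invariant_field gmul (bracket v w)"

definition diagonalisable_positive :: "('a::real_vector \<Rightarrow> 'a) \<Rightarrow> bool" where
  "diagonalisable_positive A \<longleftrightarrow> linear A \<and>
     (\<exists>B. independent B \<and> span B = UNIV \<and> (\<forall>b\<in>B. \<exists>a>0. A b = a *\<^sub>R b))"

text \<open>\<open>dilation A r\<close> is \<open>Exp (A ln r)\<close>; it is meaningful for \<open>r > 0\<close> only.\<close>

definition dilation :: "('a::real_normed_vector \<Rightarrow> 'a) \<Rightarrow> real \<Rightarrow> 'a \<Rightarrow> 'a" where
  "dilation A r x = (\<Sum>k. (ln r ^ k / fact k) *\<^sub>R (A ^^ k) x)"

locale homogeneous_group =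
  exponential_lie_group bracket gmul ginv
  for bracket :: "real ^ 'n \<Rightarrow> real ^ 'n \<Rightarrow> real ^ 'n"
    and gmul :: "real ^ 'n \<Rightarrow> real ^ 'n \<Rightarrow> real ^ 'n"
    and ginv :: "real ^ 'n \<Rightarrow> real ^ 'n" +
  fixes A :: "real ^ 'n \<Rightarrow> real ^ 'n"
  assumes diagonalisable_positive: "diagonalisable_positive A"
    and dilation_morphism:
      "r > 0 \<Longrightarrow> bracket (dilation A r v) (dilation A r w) = dilation A r (bracket v w)"

definition homogeneous_dimension :: "(real ^ 'n \<Rightarrow> real ^ 'n) \<Rightarrow> real" where
  "homogeneous_dimension A = trace (matrix A)"

definition homogeneous_quasi_norm ::
  "('a::real_normed_vector \<Rightarrow> 'a) \<Rightarrow> ('a \<Rightarrow> 'a) \<Rightarrow> ('a \<Rightarrow> real) \<Rightarrow> bool" where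
  "homogeneous_quasi_norm ginv A N \<longleftrightarrow>
     continuous_on UNIV N \<and>
     (\<forall>x. N x \<ge> 0) \<and>
     (\<forall>x. N (ginv x) = N x) \<and>
     (\<forall>r>0. \<forall>x. N (dilation A r x) = r * N x) \<and>
     (\<forall>x. N x = 0 \<longleftrightarrow> x = 0)"

text \<open>The value at \<open>x = 0\<close>, where the radial derivative is undefined, is irrelevant.\<close>

definition radial_deriv ::
  "('a::real_normed_vector \<Rightarrow> 'a) \<Rightarrow> ('a \<Rightarrow> real) \<Rightarrow> ('a \<Rightarrow> real) \<Rightarrow> 'a \<Rightarrow> real" where
  "radial_deriv A N f x = deriv (\<lambda>r. f (dilation A r (dilation A (1 / N x) x))) (N x)"

text \<open>
  The integrand of \<open>d_H\<close> takes a junk value where its denominator vanishes, i.e. at \<open>x = 0\<close> and on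
  the sphere \<open>N x = R\<close>; these are Lebesgue null sets.
\<close>

definition d_H_integrand ::
  "(real ^ 'n \<Rightarrow> real ^ 'n) \<Rightarrow> (real ^ 'n \<Rightarrow> real) \<Rightarrow> real \<Rightarrow> (real ^ 'n \<Rightarrow> real) \<Rightarrow> real \<Rightarrow>
     real ^ 'n \<Rightarrow> real" where
  "d_H_integrand A N p u R x =
     (let \<alpha> = (homogeneous_dimension A - p) / p in
        \<bar>u x - R powr \<alpha> * u (dilation A (R / N x) x) * N x powr (- \<alpha>)\<bar> powr p /
        (N x powr p * \<bar>ln (R / N x)\<bar> powr p))"

definition d_H ::
  "(real ^ 'n \<Rightarrow> real ^ 'n) \<Rightarrow> (real ^ 'n \<Rightarrow> real) \<Rightarrow> real \<Rightarrow> (real ^ 'n \<Rightarrow> real) \<Rightarrow> real \<Rightarrow> real" where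
  "d_H A N p u R = (LINT x|lborel. d_H_integrand A N p u R x) powr (1 / p)"

end

theory Submission
  imports Defs
begin

text \<open>
  Along an orbit of the dilations the problem is one-dimensional. Let \<open>Q\<close> be the homogeneous
  dimension, \<open>\<alpha> = (Q - p) / p\<close>, fix \<open>z \<noteq> 0\<close>, and parametrise the orbit logarithmically by
  \<open>x = D_r z\<close> with \<open>r = exp s\<close>. With \<open>w s = exp (\<alpha> s) * u x\<close>, the three integrands, each multiplied
  by the Jacobian \<open>exp (Q s)\<close>, become
  \<open>\<bar>w' - \<alpha> w\<bar> powr p\<close>, \<open>\<bar>w\<bar> powr p\<close> and \<open>\<bar>w s - w s0\<bar> powr p / \<bar>s - s0\<bar> powr p\<close>, where \<open>s0\<close> is
  the parameter at which the orbit crosses the sphere of radius \<open>R\<close>, all up to the common factor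
  \<open>N z powr (- p)\<close>. So \<open>d_H\<close> is the left-hand side of a Hardy inequality for the increment
  \<open>w - w s0\<close>, and two facts suffice.

  \<^item> For \<open>p \<ge> 2\<close>, uniform convexity of the \<open>p\<close>-th power gives
    \<open>\<bar>a - b\<bar> powr p \<ge> \<bar>a\<bar> powr p - p * sgn a * \<bar>a\<bar> powr (p - 1) * b + 2 powr (1 - p) * \<bar>b\<bar> powr p\<close>.
    For \<open>a = \<alpha> w\<close> and \<open>b = w'\<close> the middle term is an exact derivative, so it integrates to a
    boundary term of favourable sign, and the gain is the integral of \<open>\<bar>w'\<bar> powr p\<close>
    (\<open>hardy_remainder_derivative\<close>).

  \<^item> That integral dominates the increment quotient, with a constant that depends only on \<open>p\<close>
    (\<open>hardy_line\<close>). Hence the resulting inequality on the orbit holds with one constant for all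
    \<open>R\<close> and all orbits, and the supremum over \<open>R\<close> costs nothing.

  The orbits are put together without a measure on the unit sphere: every orbit except the origin spends logarithmic
  time exactly 1 in a shell \<open>\<rho> \<le> N z < \<rho> e\<close>, so by Tonelli's theorem and the scaling of Lebesgue
  measure an integral over the space is the integral over the shell of the integrals along the
  orbits (\<open>nn_integral_polar\<close>). Working with integrals in \<open>[0, \<infinity>]\<close>, a single finiteness statement is
  needed, that of the integral of \<open>\<bar>radial_deriv\<bar> powr p\<close>: it follows from local integrability of
  \<open>N powr (- p)\<close>, that is, from \<open>p < Q\<close>.
\<close>

section \<open>Convexity of the power function\<close>

lemma powr_ge_tangent:
  fixes p x a :: real
  assumes "1 \<le> p" "0 \<le> x" "0 \<le> a"
  shows "a powr p + p * a powr (p - 1) * (x - a) \<le> x powr p"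
proof (cases "a = 0 \<or> x = 0")
  case True
  have "a powr p = a powr (p - 1) * a" if "a \<noteq> 0"
    using that assms by (simp add: powr_diff)
  then show ?thesis
    using True assms mult_right_mono[of 1 p "a powr (p - 1) * a"] 
    by (cases "a = 0") (auto simp: mult_ac)
next
  case False
  then have pos: "0 < a" "0 < x" using assms by auto
  have "((\<lambda>t. t powr p) has_real_derivative p * a powr (p - 1)) (at a within {0<..})"
    using has_real_derivative_powr[OF pos(1)] by (rule has_field_derivative_at_within)
  then have "p * a powr (p - 1) * (x - a) \<le> x powr p - a powr p"
    using pos by (intro convex_on_imp_above_tangent[OF powr_convex[OF assms(1)]])
      (auto simp: interior_open)
  then show ?thesis by simp
qed

lemma abs_powr_ge_tangent:
  fixes p x a :: real
  assumes "1 \<le> p"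
  shows "\<bar>a\<bar> powr p + p * sgn a * \<bar>a\<bar> powr (p - 1) * (x - a) \<le> \<bar>x\<bar> powr p"
proof -
  have "sgn a * (x - a) \<le> \<bar>x\<bar> - \<bar>a\<bar>" by (auto simp: sgn_if)
  then have "(p * \<bar>a\<bar> powr (p - 1)) * (sgn a * (x - a)) \<le> (p * \<bar>a\<bar> powr (p - 1)) * (\<bar>x\<bar> - \<bar>a\<bar>)"
    using assms by (intro mult_left_mono) auto
  with powr_ge_tangent[of p "\<bar>x\<bar>" "\<bar>a\<bar>"] assms
  have "\<bar>a\<bar> powr p + (p * \<bar>a\<bar> powr (p - 1)) * (sgn a * (x - a)) \<le> \<bar>x\<bar> powr p"
    by linarith
  then show ?thesis by (simp only: mult_ac)
qed

lemma powr_superadditive: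
  fixes q s t :: real
  assumes "1 \<le> q" "0 \<le> s" "0 \<le> t"
  shows "s powr q + t powr q \<le> (s + t) powr q"
proof -
  have split: "x powr q = x * x powr (q - 1)" if "0 \<le> x" for x
    using that assms by (cases "x = 0") (auto simp: powr_diff)
  have "s * s powr (q - 1) + t * t powr (q - 1)
      \<le> s * (s + t) powr (q - 1) + t * (s + t) powr (q - 1)"
    using assms by (intro add_mono mult_left_mono powr_mono2) auto
  then show ?thesis
    using assms split[of s] split[of t] split[of "s + t"] by (simp add: distrib_right)
qed

text \<open>The parallelogram law, with superadditivity and convexity of \<open>t powr (p / 2)\<close>.\<close>

lemma clarkson_inequality_real:
  fixes p x y :: real
  assumes "2 \<le> p"
  shows "2 * (\<bar>(x + y) / 2\<bar> powr p + \<bar>(x - y) / 2\<bar> powr p) \<le> \<bar>x\<bar> powr p + \<bar>y\<bar> powr p"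
proof -
  define q where "q = p / 2"
  have q: "1 \<le> q" using assms by (simp add: q_def)
  have sq: "\<bar>z\<bar> powr p = (z\<^sup>2) powr q" for z :: real
    using powr_powr[of "\<bar>z\<bar>" 2 q] by (cases "z = 0") (auto simp: q_def)
  define m where "m = (x\<^sup>2 + y\<^sup>2) / 2"
  have m0: "0 \<le> m" by (simp add: m_def)
  have par: "((x + y) / 2)\<^sup>2 + ((x - y) / 2)\<^sup>2 = m"
    by (simp add: m_def power2_eq_square field_simps)
  have "\<bar>(x + y) / 2\<bar> powr p + \<bar>(x - y) / 2\<bar> powr p \<le> m powr q"
    unfolding sq par[symmetric] using q by (intro powr_superadditive) auto
  moreover have "2 * m powr q \<le> (x\<^sup>2) powr q + (y\<^sup>2) powr q"
  proof -
    have "p' * c * (u - m) + p' * c * (v - m) = 0" if "u + v = 2 * m" for p' c u v :: real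
      using that by (simp flip: distrib_left)
    from this[of "x\<^sup>2" "y\<^sup>2" q "m powr (q - 1)"] show ?thesis
      using powr_ge_tangent[of q "x\<^sup>2" m] powr_ge_tangent[of q "y\<^sup>2" m] q m0
      by (simp add: m_def)
  qed
  ultimately show ?thesis by (simp add: sq)
qed

text \<open>
  Clarkson's inequality bounds the value at \<open>a - b\<close> by the value at the midpoint \<open>a - b / 2\<close>,
  where the tangent at \<open>a\<close> applies; the other Clarkson term is the gain.
\<close>

lemma abs_powr_diff_ge:
  fixes p a b :: real
  assumes "2 \<le> p"
  shows "\<bar>a\<bar> powr p - p * sgn a * \<bar>a\<bar> powr (p - 1) * b + 2 powr (1 - p) * \<bar>b\<bar> powr p
      \<le> \<bar>a - b\<bar> powr p"
proof -
  have "2 * (\<bar>b\<bar> powr p / 2 powr p) = 2 powr (1 - p) * \<bar>b\<bar> powr p"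
    by (simp add: powr_diff)
  moreover have "2 * (\<bar>a - b / 2\<bar> powr p + \<bar>b\<bar> powr p / 2 powr p) \<le> \<bar>a\<bar> powr p + \<bar>a - b\<bar> powr p"
    using clarkson_inequality_real[OF assms, of a "a - b"]
    by (simp add: powr_divide abs_divide diff_divide_distrib)
  moreover have "\<bar>a\<bar> powr p - p * sgn a * \<bar>a\<bar> powr (p - 1) * (b / 2) \<le> \<bar>a - b / 2\<bar> powr p"
    using abs_powr_ge_tangent[of p a "a - b / 2"] assms by simp
  ultimately show ?thesis by simp
qed

text \<open>
  Young's inequality with a parameter. The constants come from comparing \<open>b\<close> with \<open>\<delta> * a\<close>: in
  either case one term on the right already dominates.
\<close>

lemma powr_mult_le_Young:
  fixes p a b \<delta> :: real
  assumes "1 < p" "0 < \<delta>" "0 \<le> a" "0 \<le> b"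
  shows "a powr (p - 1) * b \<le> \<delta> * a powr p + \<delta> powr (1 - p) * b powr p"
proof (cases "b \<le> \<delta> * a")
  case True
  have "a powr (p - 1) * b \<le> a powr (p - 1) * (\<delta> * a)"
    using True by (intro mult_left_mono) auto
  also have "\<dots> = \<delta> * a powr p" using assms by (cases "a = 0") (auto simp: powr_diff)
  finally show ?thesis using assms by (smt (verit) mult_nonneg_nonneg powr_ge_zero)
next
  case False
  then have b: "0 < b" and ab: "a \<le> b / \<delta>"
    using assms by (auto simp: field_simps intro: order.strict_trans1)
      (metis assms(2,3) mult_nonneg_nonneg not_le order_le_less_trans less_imp_le)
  have "a powr (p - 1) * b \<le> (b / \<delta>) powr (p - 1) * b"
    using ab assms by (intro mult_right_mono powr_mono2) auto
  also have "\<dots> = \<delta> powr (1 - p) * b powr p"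
    using assms b by (simp add: powr_divide powr_diff)
  finally show ?thesis using assms by (smt (verit) mult_nonneg_nonneg powr_ge_zero)
qed

lemma has_real_derivative_abs_powr:
  fixes p x :: real
  assumes "1 < p"
  shows "((\<lambda>x. \<bar>x\<bar> powr p) has_real_derivative p * sgn x * \<bar>x\<bar> powr (p - 1)) (at x)"
proof -
  consider "0 < x" | "x < 0" | "x = 0" by linarith
  then show ?thesis
  proof cases
    case 1
    have "((\<lambda>x. x powr p) has_real_derivative p * sgn x * \<bar>x\<bar> powr (p - 1)) (at x)"
      using has_real_derivative_powr[OF 1, of p] 1 by simp
    then show ?thesis
      by (rule has_field_derivative_transform_within_open[where S = "{0<..}"]) (use 1 in auto)
  next
    case 2
    have "((\<lambda>x. (- x) powr p) has_real_derivative p * sgn x * \<bar>x\<bar> powr (p - 1)) (at x)"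
      using 2 by (auto intro!: derivative_eq_intros)
    then show ?thesis
      by (rule has_field_derivative_transform_within_open[where S = "{..<0}"]) (use 2 in auto)
  next
    case 3
    have "((\<lambda>h::real. sgn h * \<bar>h\<bar> powr (p - 1)) \<longlongrightarrow> 0) (at 0)"
    proof (rule tendsto_rabs_zero_cancel)
      have "((\<lambda>h::real. \<bar>h\<bar> powr (p - 1)) \<longlongrightarrow> \<bar>0\<bar> powr (p - 1)) (at 0)"
        using assms by (intro tendsto_intros) auto
      then show "((\<lambda>h::real. \<bar>sgn h * \<bar>h\<bar> powr (p - 1)\<bar>) \<longlongrightarrow> 0) (at 0)"
        using assms
        by (auto simp: abs_mult abs_sgn_eq elim!: Lim_transform_eventually
            intro!: eventually_at_filter[THEN iffD2] always_eventually)
    qed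
    moreover have "\<forall>\<^sub>F h in at 0. sgn h * \<bar>h\<bar> powr (p - 1) = \<bar>h\<bar> powr p / h"
      using assms unfolding eventually_at_filter
      by (intro always_eventually) (auto simp: powr_diff sgn_if)
    ultimately have "((\<lambda>h::real. \<bar>h\<bar> powr p / h) \<longlongrightarrow> 0) (at 0)"
      by (rule Lim_transform_eventually)
    then show ?thesis using 3 assms by (simp add: DERIV_def)
  qed
qed

section \<open>Two one-dimensional inequalities\<close>

text \<open>
  Both one-dimensional inequalities have a pointwise form with an exact derivative \<open>F'\<close>. The slack
  \<open>c\<close> takes up a boundary term of unfavourable sign.
\<close>

lemma nn_integral_le_by_FTC:
  fixes f g F F' :: "real \<Rightarrow> real"
  assumes "a \<le> b"
    and F: "\<And>s. s \<in> {a..b} \<Longrightarrow> (F has_real_derivative F' s) (at s)"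
    and f: "f \<in> borel_measurable borel" "\<And>s. 0 \<le> f s" "continuous_on {a..b} f"
    and g: "g \<in> borel_measurable borel" "\<And>s. 0 \<le> g s" "continuous_on {a..b} g"
    and le: "\<And>s. s \<in> {a..b} \<Longrightarrow> f s + F' s \<le> g s"
    and c: "F a - F b \<le> c" "0 \<le> c"
  shows "(\<integral>\<^sup>+s\<in>{a..b}. f s \<partial>lborel) \<le> (\<integral>\<^sup>+s\<in>{a..b}. g s \<partial>lborel) + ennreal c"
proof -
  have eq: "(\<integral>\<^sup>+s\<in>{a..b}. h s \<partial>lborel) = ennreal (integral {a..b} h)"
    if [measurable]: "h \<in> borel_measurable borel"
      and h: "\<And>s. 0 \<le> h s" "continuous_on {a..b} h" for h :: "real \<Rightarrow> real"
  proof -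
    have "(h has_integral integral {a..b} h) {a..b}"
      using h(2) by (intro integrable_integral integrable_continuous_real)
    then have "((\<lambda>s. if s \<in> {a..b} then h s else 0) has_integral integral {a..b} h) UNIV"
      by (rule has_integral_restrict_UNIV[THEN iffD2])
    moreover have "(\<lambda>s. if s \<in> {a..b} then h s else 0) = (\<lambda>s. h s * indicator {a..b} s)"
      by (auto simp: indicator_def)
    ultimately have "((\<lambda>s. h s * indicator {a..b} s) has_integral integral {a..b} h) UNIV"
      by (simp only:)
    then have "(\<integral>\<^sup>+s. ennreal (h s * indicator {a..b} s) \<partial>lborel) = ennreal (integral {a..b} h)"
      using h(1) by (intro nn_integral_has_integral_lborel) auto
    then show ?thesis by (simp add: ennreal_mult'' ennreal_indicator)
  qed
  have "(F' has_integral F b - F a) {a..b}"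
    using assms(1) F
    by (intro fundamental_theorem_of_calculus)
      (auto simp flip: has_real_derivative_iff_has_vector_derivative
        intro: has_field_derivative_at_within)
  then have "((\<lambda>s. f s + F' s) has_integral integral {a..b} f + (F b - F a)) {a..b}"
    by (intro has_integral_add integrable_integral integrable_continuous_real f)
  moreover have "(g has_integral integral {a..b} g) {a..b}"
    by (intro integrable_integral integrable_continuous_real g)
  ultimately have "integral {a..b} f + (F b - F a) \<le> integral {a..b} g"
    using le by (rule has_integral_le) auto
  then have "ennreal (integral {a..b} f) \<le> ennreal (integral {a..b} g + c)"
    using c by (intro ennreal_leI) auto
  also have "\<dots> = ennreal (integral {a..b} g) + ennreal c"
    using c g by (intro ennreal_plus integral_nonneg integrable_continuous_real) auto
  finally show ?thesis using f g by (simp add: eq)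
qed

lemma nn_integral_le_exhaustion:
  fixes f g :: "real \<Rightarrow> ennreal" and B :: "nat \<Rightarrow> real set"
  assumes f[measurable]: "f \<in> borel_measurable borel"
    and B[measurable]: "\<And>n. B n \<in> sets borel" and inc: "incseq B"
    and le: "\<forall>\<^sub>F n in sequentially. (\<integral>\<^sup>+s\<in>B n. f s \<partial>lborel) \<le> (\<integral>\<^sup>+s\<in>B n. g s \<partial>lborel) + e n"
    and e: "e \<longlonglongrightarrow> 0"
  shows "(\<integral>\<^sup>+s\<in>(\<Union>n. B n). f s \<partial>lborel) \<le> (\<integral>\<^sup>+s\<in>(\<Union>n. B n). g s \<partial>lborel)"
proof (rule tendsto_le)
  show "(\<lambda>n. (\<integral>\<^sup>+s\<in>B n. f s \<partial>lborel)) \<longlonglongrightarrow> (\<integral>\<^sup>+s\<in>(\<Union>n. B n). f s \<partial>lborel)"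
  proof (rule nn_integral_LIMSEQ)
    show "incseq (\<lambda>n s. f s * indicator (B n) s)"
      using inc by (auto simp: incseq_def le_fun_def indicator_def)
    show "(\<lambda>n. f s * indicator (B n) s) \<longlonglongrightarrow> f s * indicator (\<Union>n. B n) s" for s
    proof (cases "s \<in> (\<Union>n. B n)")
      case True
      then obtain n where "s \<in> B n" by auto
      then have "\<forall>m\<ge>n. s \<in> B m" using inc by (auto simp: incseq_def)
      then have "\<forall>\<^sub>F m in sequentially. f s * indicator (B m) s = f s"
        by (auto simp: eventually_sequentially intro!: exI[of _ n])
      then show ?thesis using True by (simp add: tendsto_eventually)
    qed auto
  qed auto
  have "(\<lambda>n. (\<integral>\<^sup>+s\<in>(\<Union>n. B n). g s \<partial>lborel) + e n) \<longlonglongrightarrow> (\<integral>\<^sup>+s\<in>(\<Union>n. B n). g s \<partial>lborel) + 0"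
    by (intro tendsto_add tendsto_const e)
  then show "(\<lambda>n. (\<integral>\<^sup>+s\<in>(\<Union>n. B n). g s \<partial>lborel) + e n) \<longlonglongrightarrow> (\<integral>\<^sup>+s\<in>(\<Union>n. B n). g s \<partial>lborel)"
    by simp
  have "(\<integral>\<^sup>+s\<in>B n. g s \<partial>lborel) \<le> (\<integral>\<^sup>+s\<in>(\<Union>n. B n). g s \<partial>lborel)" for n
    by (intro nn_integral_mono) (auto simp: indicator_def)
  then show "\<forall>\<^sub>F n in sequentially.
      (\<integral>\<^sup>+s\<in>B n. f s \<partial>lborel) \<le> (\<integral>\<^sup>+s\<in>(\<Union>n. B n). g s \<partial>lborel) + e n"
    using le by (auto elim!: eventually_mono intro: order_trans add_right_mono)
qed simp

text \<open>
  Not the sharp constant: Young's inequality replaces that of Hoelder, so the left-hand side can be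
  absorbed pointwise, before any integral is known to be finite.
\<close>

definition hardy_const :: "real \<Rightarrow> real" where
  "hardy_const p = 2 / (p - 1) * (p * ((p - 1) / (2 * p)) powr (1 - p))"

lemma hardy_const_pos: "1 < p \<Longrightarrow> 0 < hardy_const p"
  by (auto simp: hardy_const_def intro!: mult_pos_pos divide_pos_pos)

text \<open>
  \<open>G t = k * \<bar>f t\<bar> powr p * t powr (1 - p)\<close> is \<open>t\<close> times the integrand, up to the constant \<open>k\<close>. Since
  \<open>f t / t\<close> converges to \<open>f' 0\<close>, it tends to 0 as \<open>t\<close> does, and at the right end its sign is
  favourable.
\<close>

lemma hardy_half_line:
  fixes f f' :: "real \<Rightarrow> real"
  assumes p: "1 < p" and f: "\<And>t. (f has_real_derivative f' t) (at t)"
    and f'[continuous_intros]: "continuous_on UNIV f'" and f0: "f 0 = 0"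
  shows "(\<integral>\<^sup>+t\<in>{0<..}. \<bar>f t\<bar> powr p / \<bar>t\<bar> powr p \<partial>lborel)
      \<le> (\<integral>\<^sup>+t\<in>{0<..}. hardy_const p * \<bar>f' t\<bar> powr p \<partial>lborel)"
proof -
  have contf[continuous_intros]: "continuous_on S f" for S
    using f by (meson DERIV_isCont continuous_at_imp_continuous_on)
  have [measurable]: "f \<in> borel_measurable borel" "f' \<in> borel_measurable borel"
    using contf[of UNIV] f' by (auto intro: borel_measurable_continuous_onI)
  define \<delta> where "\<delta> = (p - 1) / (2 * p)"
  have \<delta>: "0 < \<delta>" "p * \<delta> = (p - 1) / 2" using p by (auto simp: \<delta>_def)
  define k where "k = 2 / (p - 1)"
  have k: "0 < k" "k * (p - 1) = 2" using p by (auto simp: k_def divide_simps)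
  have hc: "hardy_const p = k * (p * \<delta> powr (1 - p))"
    by (simp add: hardy_const_def k_def \<delta>_def)
  define G where "G t = k * (\<bar>f t\<bar> powr p * t powr (1 - p))" for t
  define G' where "G' t = k * (p * sgn (f t) * \<bar>f t\<bar> powr (p - 1) * f' t * t powr (1 - p)
      + \<bar>f t\<bar> powr p * ((1 - p) * t powr (- p)))" for t
  have G: "(G has_real_derivative G' t) (at t)" if "0 < t" for t
    unfolding G_def
    by (rule DERIV_cong[OF DERIV_cmult[OF DERIV_mult[OF
          DERIV_chain2[OF has_real_derivative_abs_powr[OF p] f]
          has_real_derivative_powr[OF that]]]])
      (simp add: G'_def mult_ac)
  have G0: "0 \<le> G t" for t using k by (simp add: G_def)
  \<comment> \<open>Young's inequality with \<open>\<delta>\<close> absorbs half of the good term of \<open>G'\<close>.\<close>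
  have pointwise: "\<bar>f t\<bar> powr p / \<bar>t\<bar> powr p + G' t \<le> hardy_const p * \<bar>f' t\<bar> powr p"
    if t: "0 < t" for t
  proof -
    define a where "a = \<bar>f t\<bar> / t"
    have a: "0 \<le> a" "a powr p = \<bar>f t\<bar> powr p / t powr p" using t by (auto simp: a_def powr_divide)
    have a1: "a powr (p - 1) = \<bar>f t\<bar> powr (p - 1) * t powr (1 - p)"
      using t by (simp add: a_def powr_divide powr_diff divide_simps)
    have "G' t = k * (p * (sgn (f t) * f' t) * a powr (p - 1) - (p - 1) * a powr p)"
      using t by (simp add: G'_def a a1 powr_minus divide_inverse algebra_simps)
    also have "\<dots> \<le> k * (p * (\<delta> * a powr p + \<delta> powr (1 - p) * \<bar>f' t\<bar> powr p) - (p - 1) * a powr p)"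
    proof -
      have "sgn (f t) * f' t \<le> \<bar>f' t\<bar>" by (auto simp: sgn_if)
      then have "(sgn (f t) * f' t) * a powr (p - 1) \<le> \<bar>f' t\<bar> * a powr (p - 1)"
        by (rule mult_right_mono) simp
      also have "\<dots> \<le> \<delta> * a powr p + \<delta> powr (1 - p) * \<bar>f' t\<bar> powr p"
        using powr_mult_le_Young[OF p \<delta>(1) a(1), of "\<bar>f' t\<bar>"] by (simp add: mult_ac)
      finally have "p * ((sgn (f t) * f' t) * a powr (p - 1))
          \<le> p * (\<delta> * a powr p + \<delta> powr (1 - p) * \<bar>f' t\<bar> powr p)"
        using p by (intro mult_left_mono) auto
      then show ?thesis using k by (intro mult_left_mono) (auto simp: mult.assoc)
    qed
    also have "\<dots> = k * (p * \<delta>) * a powr p - k * (p - 1) * a powr p + hardy_const p * \<bar>f' t\<bar> powr p"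
      by (simp add: hc algebra_simps)
    also have "\<dots> = - (a powr p) + hardy_const p * \<bar>f' t\<bar> powr p"
      using k(2) by (simp add: \<delta>(2))
    finally show ?thesis using t by (simp add: a(2))
  qed
  define B where "B n = {1 / real (Suc n)..real (Suc n)}" for n
  have incB: "incseq B"
  proof (rule incseq_SucI)
    show "B n \<subseteq> B (Suc n)" for n
      using frac_le[of 1 1 "real (Suc n)" "real (Suc (Suc n))"] by (auto simp: B_def)
  qed
  have UB: "(\<Union>n. B n) = {0<..}"
  proof (intro equalityI subsetI)
    fix t :: real assume "t \<in> {0<..}"
    moreover obtain n where "max t (1 / t) < real n" using reals_Archimedean2 by blast
    ultimately have "t \<in> B n" by (auto simp: B_def field_simps)
    then show "t \<in> (\<Union>n. B n)" by blast
  qed (auto simp: B_def intro: order.strict_trans2[rotated])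
  have "(\<integral>\<^sup>+t\<in>(\<Union>n. B n). \<bar>f t\<bar> powr p / \<bar>t\<bar> powr p \<partial>lborel)
      \<le> (\<integral>\<^sup>+t\<in>(\<Union>n. B n). hardy_const p * \<bar>f' t\<bar> powr p \<partial>lborel)"
  proof (rule nn_integral_le_exhaustion[OF _ _ incB always_eventually])
    show "\<forall>n. (\<integral>\<^sup>+t\<in>B n. \<bar>f t\<bar> powr p / \<bar>t\<bar> powr p \<partial>lborel)
        \<le> (\<integral>\<^sup>+t\<in>B n. hardy_const p * \<bar>f' t\<bar> powr p \<partial>lborel) + ennreal (G (1 / real (Suc n)))"
    proof
      fix n
      have pos: "0 < t" if "t \<in> B n" for t using that by (auto simp: B_def intro: order.strict_trans2[rotated])
      have le1: "1 / real (Suc n) \<le> real (Suc n)"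
        by (rule order_trans[of _ 1]) (auto simp: field_simps)
      show "(\<integral>\<^sup>+t\<in>B n. \<bar>f t\<bar> powr p / \<bar>t\<bar> powr p \<partial>lborel)
        \<le> (\<integral>\<^sup>+t\<in>B n. hardy_const p * \<bar>f' t\<bar> powr p \<partial>lborel) + ennreal (G (1 / real (Suc n)))"
        unfolding B_def
      proof (rule nn_integral_le_by_FTC[where F = G and F' = G'])
        show "continuous_on {1 / real (Suc n)..real (Suc n)} (\<lambda>t. \<bar>f t\<bar> powr p / \<bar>t\<bar> powr p)"
          using pos p unfolding B_def by (intro continuous_intros continuous_on_powr') force+
        show "continuous_on {1 / real (Suc n)..real (Suc n)} (\<lambda>t. hardy_const p * \<bar>f' t\<bar> powr p)"
          using p by (intro continuous_intros continuous_on_powr' continuous_on_subset[OF f']) auto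
        show "\<bar>f t\<bar> powr p / \<bar>t\<bar> powr p + G' t \<le> hardy_const p * \<bar>f' t\<bar> powr p"
          if "t \<in> {1 / real (Suc n)..real (Suc n)}" for t
          using that by (intro pointwise pos) (simp add: B_def)
      qed (use pos hardy_const_pos[OF p] G G0 le1 in \<open>auto simp: B_def\<close>)
    qed
    show "(\<lambda>n. ennreal (G (1 / real (Suc n)))) \<longlonglongrightarrow> 0"
    proof -
      have inv: "(\<lambda>n. 1 / real (Suc n)) \<longlonglongrightarrow> 0" by (rule LIMSEQ_Suc[OF lim_1_over_n])
      have "((\<lambda>h. f h / h) \<longlongrightarrow> f' 0) (at 0)" using f[of 0] f0 by (simp add: DERIV_def)
      then have "(\<lambda>n. f (1 / real (Suc n)) / (1 / real (Suc n))) \<longlonglongrightarrow> f' 0"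
        by (rule tendsto_compose_eventually[OF _ inv]) auto
      then have "(\<lambda>n. k * (\<bar>f (1 / real (Suc n)) / (1 / real (Suc n))\<bar> powr p * (1 / real (Suc n))))
          \<longlonglongrightarrow> k * (\<bar>f' 0\<bar> powr p * 0)"
        using p by (intro tendsto_intros inv) auto
      moreover have G_eq: "k * (\<bar>f t / t\<bar> powr p * t) = G t" if "0 < t" for t
        using that by (simp add: G_def powr_divide powr_diff abs_divide)
      ultimately have "(\<lambda>n. G (1 / real (Suc n))) \<longlonglongrightarrow> k * (\<bar>f' 0\<bar> powr p * 0)"
        by (subst (asm) G_eq) simp_all
      then have "(\<lambda>n. G (1 / real (Suc n))) \<longlonglongrightarrow> 0" by simp
      from tendsto_ennrealI[OF this] show ?thesis by simp
    qed
  qed (auto simp: B_def)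
  then show ?thesis unfolding UB .
qed

text \<open>
  Translation and reflection reduce each side of \<open>s0\<close> to the half-line.
\<close>

lemma hardy_line:
  fixes w w' :: "real \<Rightarrow> real"
  assumes p: "1 < p" and w: "\<And>t. (w has_real_derivative w' t) (at t)"
    and w': "continuous_on UNIV w'"
  shows "(\<integral>\<^sup>+s. \<bar>w s - w s0\<bar> powr p / \<bar>s - s0\<bar> powr p \<partial>lborel)
      \<le> (\<integral>\<^sup>+s. hardy_const p * \<bar>w' s\<bar> powr p \<partial>lborel)"
proof -
  have contw: "continuous_on UNIV w"
    using w by (meson DERIV_isCont continuous_at_imp_continuous_on)
  have [measurable]: "w \<in> borel_measurable borel" "w' \<in> borel_measurable borel"
    using contw w' by (auto intro: borel_measurable_continuous_onI)
  have split: "(\<integral>\<^sup>+s. h s \<partial>lborel)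
      = (\<integral>\<^sup>+t\<in>{0<..}. h (s0 + t) \<partial>lborel) + (\<integral>\<^sup>+t\<in>{0<..}. h (s0 - t) \<partial>lborel)"
    if h[measurable]: "h \<in> borel_measurable borel" for h :: "real \<Rightarrow> ennreal"
  proof -
    have "(\<integral>\<^sup>+s. h s \<partial>lborel) = (\<integral>\<^sup>+t. h (s0 + t) \<partial>lborel)"
      using nn_integral_real_affine[of h 1 s0] by simp
    also have "\<dots> = (\<integral>\<^sup>+t. h (s0 + t) * indicator {0<..} t + h (s0 + t) * indicator {..<0} t \<partial>lborel)"
      by (rule nn_integral_cong_AE, use AE_lborel_singleton[of "0::real"] in eventually_elim)
        (auto simp: indicator_def)
    also have "\<dots> = (\<integral>\<^sup>+t\<in>{0<..}. h (s0 + t) \<partial>lborel) + (\<integral>\<^sup>+t\<in>{..<0}. h (s0 + t) \<partial>lborel)"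
      by (rule nn_integral_add) auto
    also have "(\<integral>\<^sup>+t\<in>{..<0}. h (s0 + t) \<partial>lborel) = (\<integral>\<^sup>+t\<in>{0<..}. h (s0 - t) \<partial>lborel)"
      by (subst nn_integral_real_affine[where c = "-1" and t = 0])
        (auto intro!: nn_integral_cong simp: indicator_def)
    finally show ?thesis .
  qed
  have "((\<lambda>t. w (s0 + t) - w s0) has_real_derivative w' (s0 + t)) (at t)" for t
    by (rule DERIV_cong[OF DERIV_diff[OF DERIV_chain2[OF w DERIV_add[OF DERIV_const DERIV_ident]]
          DERIV_const]]) simp
  moreover have "continuous_on UNIV (\<lambda>t. w' (s0 + t))"
    by (intro continuous_on_compose2[OF w'] continuous_intros) auto
  ultimately have plus: "(\<integral>\<^sup>+t\<in>{0<..}. \<bar>w (s0 + t) - w s0\<bar> powr p / \<bar>t\<bar> powr p \<partial>lborel)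
      \<le> (\<integral>\<^sup>+t\<in>{0<..}. hardy_const p * \<bar>w' (s0 + t)\<bar> powr p \<partial>lborel)"
    by (rule hardy_half_line[OF p]) auto
  have "((\<lambda>t. w (s0 - t) - w s0) has_real_derivative - w' (s0 - t)) (at t)" for t
    by (rule DERIV_cong[OF DERIV_diff[OF DERIV_chain2[OF w DERIV_diff[OF DERIV_const DERIV_ident]]
          DERIV_const]]) simp
  moreover have "continuous_on UNIV (\<lambda>t. - w' (s0 - t))"
    by (intro continuous_on_minus continuous_on_compose2[OF w'] continuous_intros) auto
  ultimately have "(\<integral>\<^sup>+t\<in>{0<..}. \<bar>w (s0 - t) - w s0\<bar> powr p / \<bar>t\<bar> powr p \<partial>lborel)
      \<le> (\<integral>\<^sup>+t\<in>{0<..}. hardy_const p * \<bar>- w' (s0 - t)\<bar> powr p \<partial>lborel)"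
    by (rule hardy_half_line[OF p]) auto
  then have minus: "(\<integral>\<^sup>+t\<in>{0<..}. \<bar>w (s0 - t) - w s0\<bar> powr p / \<bar>- t\<bar> powr p \<partial>lborel)
      \<le> (\<integral>\<^sup>+t\<in>{0<..}. hardy_const p * \<bar>w' (s0 - t)\<bar> powr p \<partial>lborel)"
    by simp
  show ?thesis
    using add_mono[OF plus minus] by (subst (1 2) split) auto
qed

text \<open>
  With \<open>a = \<alpha> w\<close> and \<open>b = w'\<close>, the middle term of \<open>abs_powr_diff_ge\<close> is the derivative of
  \<open>\<alpha> powr (p - 1) * \<bar>w\<bar> powr p\<close>. Integrated up to a zero of \<open>w\<close>, it has a favourable
  sign whatever \<open>w\<close> does at the left end.
\<close>

lemma hardy_remainder_derivative:
  fixes w w' :: "real \<Rightarrow> real"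
  assumes p: "2 \<le> p" and \<alpha>: "0 < \<alpha>"
    and w: "\<And>t. (w has_real_derivative w' t) (at t)"
    and w': "continuous_on UNIV w'" and zero: "\<And>s. b < s \<Longrightarrow> w s = 0"
  shows "(\<integral>\<^sup>+s. \<alpha> powr p * \<bar>w s\<bar> powr p + 2 powr (1 - p) * \<bar>w' s\<bar> powr p \<partial>lborel)
      \<le> (\<integral>\<^sup>+s. \<bar>w' s - \<alpha> * w s\<bar> powr p \<partial>lborel)"
proof -
  have contw: "continuous_on UNIV w"
    using w by (meson DERIV_isCont continuous_at_imp_continuous_on)
  have [measurable]: "w \<in> borel_measurable borel" "w' \<in> borel_measurable borel"
    using contw w' by (auto intro: borel_measurable_continuous_onI)
  define F where "F s = - (\<alpha> powr (p - 1) * \<bar>w s\<bar> powr p)" for s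
  define F' where "F' s = - (\<alpha> powr (p - 1) * (p * sgn (w s) * \<bar>w s\<bar> powr (p - 1) * w' s))" for s
  have F: "(F has_real_derivative F' s) (at s)" for s
    unfolding F_def F'_def
    using DERIV_chain2[OF has_real_derivative_abs_powr[of p "w s"] w[of s]] p
    by (auto intro!: DERIV_minus DERIV_cmult)
  have pointwise: "\<alpha> powr p * \<bar>w s\<bar> powr p + 2 powr (1 - p) * \<bar>w' s\<bar> powr p + F' s
      \<le> \<bar>w' s - \<alpha> * w s\<bar> powr p" for s
    using abs_powr_diff_ge[OF p, of "\<alpha> * w s" "w' s"] \<alpha>
    by (simp add: F'_def abs_mult powr_mult sgn_mult abs_minus_commute mult_ac)
  define B where "B n = {- real n..real n}" for n
  have UB: "(\<Union>n. B n) = UNIV"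
  proof -
    have "\<exists>n. s \<in> B n" for s
    proof -
      obtain n where "\<bar>s\<bar> < real n" using reals_Archimedean2 by blast
      then show ?thesis by (auto simp: B_def intro!: exI[of _ n])
    qed
    then show ?thesis by auto
  qed
  obtain N where N: "b < real N" using reals_Archimedean2 by blast
  have "(\<integral>\<^sup>+s\<in>(\<Union>n. B n). \<alpha> powr p * \<bar>w s\<bar> powr p + 2 powr (1 - p) * \<bar>w' s\<bar> powr p \<partial>lborel)
      \<le> (\<integral>\<^sup>+s\<in>(\<Union>n. B n). \<bar>w' s - \<alpha> * w s\<bar> powr p \<partial>lborel)"
  proof (rule nn_integral_le_exhaustion)
    show "incseq B" by (auto simp: B_def incseq_def)
    show "\<forall>\<^sub>F n in sequentially.
        (\<integral>\<^sup>+s\<in>B n. \<alpha> powr p * \<bar>w s\<bar> powr p + 2 powr (1 - p) * \<bar>w' s\<bar> powr p \<partial>lborel)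
      \<le> (\<integral>\<^sup>+s\<in>B n. \<bar>w' s - \<alpha> * w s\<bar> powr p \<partial>lborel) + ennreal 0"
      using eventually_ge_at_top[of N]
    proof eventually_elim
      case (elim n)
      then have "F (real n) = 0" using zero N p by (auto simp: F_def)
      moreover have "F (- real n) \<le> 0" by (auto simp: F_def)
      ultimately show ?case
        unfolding B_def
        using F pointwise p
        by (intro nn_integral_le_by_FTC[where F = F and F' = F'])
          (auto intro!: continuous_intros continuous_on_powr' continuous_on_subset[OF w']
            continuous_on_subset[OF contw])
    qed
  qed (auto simp: B_def)
  then show ?thesis by (simp add: UB)
qed

text \<open>
  This is the whole inequality on one orbit: Hardy's inequality trades the gain
  \<open>\<bar>w'\<bar> powr p\<close> for the increment quotient at \<open>s0\<close>.
\<close>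

lemma log_radial_hardy:
  fixes w w' :: "real \<Rightarrow> real"
  assumes p: "2 \<le> p" and \<alpha>: "0 < \<alpha>"
    and w: "\<And>t. (w has_real_derivative w' t) (at t)"
    and w': "continuous_on UNIV w'" and zero: "\<And>s. b < s \<Longrightarrow> w s = 0"
  shows "ennreal (\<alpha> powr p) * (\<integral>\<^sup>+s. \<bar>w s\<bar> powr p \<partial>lborel)
      + ennreal (2 powr (1 - p) / hardy_const p) * (\<integral>\<^sup>+s. \<bar>w s - w s0\<bar> powr p / \<bar>s - s0\<bar> powr p \<partial>lborel)
      \<le> (\<integral>\<^sup>+s. \<bar>w' s - \<alpha> * w s\<bar> powr p \<partial>lborel)"
proof -
  have contw: "continuous_on UNIV w"
    using w by (meson DERIV_isCont continuous_at_imp_continuous_on)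
  have [measurable]: "w \<in> borel_measurable borel" "w' \<in> borel_measurable borel"
    using contw w' by (auto intro: borel_measurable_continuous_onI)
  let ?h = "hardy_const p" and ?c = "2 powr (1 - p)"
  have h: "0 < ?h" using p by (intro hardy_const_pos) auto
  have "ennreal (?c / ?h) * (\<integral>\<^sup>+s. \<bar>w s - w s0\<bar> powr p / \<bar>s - s0\<bar> powr p \<partial>lborel)
      \<le> ennreal (?c / ?h) * (\<integral>\<^sup>+s. ?h * \<bar>w' s\<bar> powr p \<partial>lborel)"
    using p by (intro mult_left_mono hardy_line w w') auto
  also have "\<dots> = (\<integral>\<^sup>+s. ?c * \<bar>w' s\<bar> powr p \<partial>lborel)"
    using h by (subst nn_integral_cmult[symmetric]) (auto simp flip: ennreal_mult)
  finally have "ennreal (\<alpha> powr p) * (\<integral>\<^sup>+s. \<bar>w s\<bar> powr p \<partial>lborel)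
      + ennreal (?c / ?h) * (\<integral>\<^sup>+s. \<bar>w s - w s0\<bar> powr p / \<bar>s - s0\<bar> powr p \<partial>lborel)
      \<le> ennreal (\<alpha> powr p) * (\<integral>\<^sup>+s. \<bar>w s\<bar> powr p \<partial>lborel) + (\<integral>\<^sup>+s. ?c * \<bar>w' s\<bar> powr p \<partial>lborel)"
    by (rule add_left_mono)
  also have "\<dots> = (\<integral>\<^sup>+s. \<alpha> powr p * \<bar>w s\<bar> powr p + ?c * \<bar>w' s\<bar> powr p \<partial>lborel)"
    by (subst nn_integral_cmult[symmetric], simp, subst nn_integral_add[symmetric])
      (auto simp flip: ennreal_mult' ennreal_plus)
  also have "\<dots> \<le> (\<integral>\<^sup>+s. \<bar>w' s - \<alpha> * w s\<bar> powr p \<partial>lborel)"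
    by (rule hardy_remainder_derivative[OF p \<alpha> w w' zero])
  finally show ?thesis .
qed

section \<open>Diagonal form of the dilations\<close>

text \<open>
  Uniqueness of a translation invariant measure: both sides are translation invariant in \<open>F\<close>, and
  testing against a density \<open>g\<close> of total mass 1 identifies the factor. The factor can stay
  unspecified, because a change of basis is used together with its inverse and the two cancel.
\<close>

lemma linear_change_of_variables:
  fixes T S :: "'a::euclidean_space \<Rightarrow> 'a"
  assumes T: "linear T" and inv: "\<And>x. T (S x) = x"
  shows "\<exists>c. \<forall>F\<in>borel_measurable borel. (\<integral>\<^sup>+x. F (T x) \<partial>lborel) = c * (\<integral>\<^sup>+x. F x \<partial>lborel)"
proof -
  have [measurable]: "T \<in> borel \<rightarrow>\<^sub>M borel"
    using T by (intro borel_measurable_continuous_onI linear_continuous_on linear_conv_bounded_linear[THEN iffD1])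
  have shift: "(\<integral>\<^sup>+x. h (t + x) \<partial>lborel) = (\<integral>\<^sup>+x. h x \<partial>lborel)"
    if [measurable]: "h \<in> borel_measurable borel" for h :: "'a \<Rightarrow> ennreal" and t
    by (subst lborel_distr_plus[of t, symmetric]) (simp add: nn_integral_distr)
  define \<beta> where "\<beta> = emeasure lborel (ball (0::'a) 1)"
  have \<beta>: "\<beta> \<noteq> 0" "\<beta> \<noteq> top"
    using emeasure_lborel_ball_finite[of "0::'a" 1] content_ball_pos[of 1 "0::'a"]
    by (auto simp: \<beta>_def emeasure_eq_ennreal_measure)
  have [measurable]: "ball (0::'a) 1 \<in> sets borel" by simp
  define g :: "'a \<Rightarrow> ennreal" where "g y = indicator (ball 0 1) y / \<beta>" for y
  have g[measurable]: "g \<in> borel_measurable borel"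
    unfolding g_def divide_ennreal_def by measurable
  have g1: "(\<integral>\<^sup>+y. g y \<partial>lborel) = 1"
    using \<beta> unfolding g_def
    by (subst nn_integral_divide) (auto simp: less_top simp flip: \<beta>_def intro!: ennreal_divide_self)
  show ?thesis
  proof (intro exI ballI)
    fix F :: "'a \<Rightarrow> ennreal" assume [measurable]: "F \<in> borel_measurable borel"
    have "(\<integral>\<^sup>+x. F (T x) \<partial>lborel) = (\<integral>\<^sup>+x. F (T x) * (\<integral>\<^sup>+y. g y \<partial>lborel) \<partial>lborel)"
      by (simp add: g1)
    also have "\<dots> = (\<integral>\<^sup>+x. (\<integral>\<^sup>+y. F (T x) * g (- T x + y) \<partial>lborel) \<partial>lborel)"
    proof -
      have "(\<integral>\<^sup>+y. F (T x) * g (- T x + y) \<partial>lborel) = F (T x) * (\<integral>\<^sup>+y. g (- T x + y) \<partial>lborel)" for x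
        by (rule nn_integral_cmult) measurable
      then show ?thesis by (simp only: shift[OF g])
    qed
    also have "\<dots> = (\<integral>\<^sup>+y. (\<integral>\<^sup>+x. F (T x) * g (- T x + y) \<partial>lborel) \<partial>lborel)"
      by (rule lborel_pair.Fubini') measurable
    also have "\<dots> = (\<integral>\<^sup>+y. (\<integral>\<^sup>+x. F (T x + y) * g (- T x) \<partial>lborel) \<partial>lborel)"
    proof (rule nn_integral_cong)
      fix y
      have "(\<integral>\<^sup>+x. F (T x) * g (- T x + y) \<partial>lborel)
          = (\<integral>\<^sup>+x. F (T (S y + x)) * g (- T (S y + x) + y) \<partial>lborel)"
        using shift[of "\<lambda>x. F (T x) * g (- T x + y)" "S y"] by simp
      then show "(\<integral>\<^sup>+x. F (T x) * g (- T x + y) \<partial>lborel) = (\<integral>\<^sup>+x. F (T x + y) * g (- T x) \<partial>lborel)"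
        by (simp add: linear_add[OF T] inv add.commute)
    qed
    also have "\<dots> = (\<integral>\<^sup>+x. (\<integral>\<^sup>+y. F (T x + y) * g (- T x) \<partial>lborel) \<partial>lborel)"
      by (rule lborel_pair.Fubini'[symmetric]) measurable
    also have "\<dots> = (\<integral>\<^sup>+x. g (- T x) \<partial>lborel) * (\<integral>\<^sup>+x. F x \<partial>lborel)"
    proof -
      have "(\<integral>\<^sup>+y. F (T x + y) * g (- T x) \<partial>lborel) = (\<integral>\<^sup>+y. F (T x + y) \<partial>lborel) * g (- T x)" for x
        by (rule nn_integral_multc) measurable
      moreover have "(\<integral>\<^sup>+x. (\<integral>\<^sup>+y. F y \<partial>lborel) * g (- T x) \<partial>lborel)
          = (\<integral>\<^sup>+y. F y \<partial>lborel) * (\<integral>\<^sup>+x. g (- T x) \<partial>lborel)"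
        by (rule nn_integral_cmult) measurable
      moreover have "(\<integral>\<^sup>+y. F (T x + y) \<partial>lborel) = (\<integral>\<^sup>+y. F y \<partial>lborel)" for x
        by (rule shift) measurable
      ultimately show ?thesis by (simp only: mult.commute)
    qed
    finally show "(\<integral>\<^sup>+x. F (T x) \<partial>lborel) = (\<integral>\<^sup>+x. g (- T x) \<partial>lborel) * (\<integral>\<^sup>+x. F x \<partial>lborel)" .
  qed
qed

text \<open>The columns of \<open>V\<close> are an eigenbasis of \<open>A\<close>, with eigenvalues \<open>a\<close>; \<open>W\<close> gives coordinates in it.\<close>

locale diagonal_form =
  fixes A :: "real ^ 'n \<Rightarrow> real ^ 'n" and V W :: "real ^ 'n ^ 'n" and a :: "'n \<Rightarrow> real"
  assumes VW: "V ** W = mat 1" and WV: "W ** V = mat 1"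
    and a_pos: "0 < a i"
    and A_eigen: "A (V *v y) = V *v (\<chi> i. a i * y $ i)"

lemma diagonalisable_positive_imp_diagonal_form:
  fixes A :: "real ^ 'n \<Rightarrow> real ^ 'n"
  assumes "diagonalisable_positive A"
  obtains V W a where "diagonal_form A V W a"
proof -
  from assms obtain B where lin: "linear A" and B: "independent B" "span B = UNIV"
    and eig: "\<forall>b\<in>B. \<exists>a>0. A b = a *\<^sub>R b"
    by (auto simp: diagonalisable_positive_def)
  have fin: "finite B" using B(1) by (rule independent_imp_finite)
  have "card B = CARD('n)"
    using indep_card_eq_dim_span[OF B(1)] B(2) by (simp add: dim_UNIV)
  then obtain f where f: "bij_betw f (UNIV :: 'n set) B"
    using fin by (metis finite_class.finite_UNIV finite_same_card_bij)
  then have fB: "range f = B" by (simp add: bij_betw_def)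
  from eig fB have "\<forall>i. \<exists>c>0. A (f i) = c *\<^sub>R f i" by auto
  then obtain a where a: "\<And>i. 0 < a i" "\<And>i. A (f i) = a i *\<^sub>R f i" by metis
  define V :: "real ^ 'n ^ 'n" where "V = (\<chi> r i. f i $ r)"
  have col: "column i V = f i" for i by (simp add: column_def V_def vec_eq_iff)
  have "columns V = B" using fB by (auto simp: columns_def col)
  then have "span (columns V) = UNIV" using B by simp
  then obtain W where W: "V ** W = mat 1"
    using matrix_right_invertible_span_columns[of V] by (auto simp: span_vec_eq)
  have "diagonal_form A V W a"
  proof
    show "W ** V = mat 1" using W matrix_left_right_inverse by blast
    show "A (V *v y) = V *v (\<chi> i. a i * y $ i)" for y
      by (simp add: matrix_mult_sum col linear_sum[OF lin] scalar_mult_eq_scaleR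
          linear_scale[OF lin] a mult.commute)
  qed (use W a in auto)
  then show thesis by (rule that)
qed

context diagonal_form
begin

text \<open>The dilations as an additive one-parameter group: \<open>flow s\<close> dilates by \<open>exp s\<close>.\<close>

definition flow :: "real \<Rightarrow> real ^ 'n \<Rightarrow> real ^ 'n" where
  "flow s x = V *v (\<chi> i. exp (s * a i) * (W *v x) $ i)"

lemma WV_cancel [simp]: "W *v (V *v y) = y"
  by (simp add: matrix_vector_mul_assoc WV)

lemma VW_cancel [simp]: "V *v (W *v y) = y"
  by (simp add: matrix_vector_mul_assoc VW)

lemma A_eq: "A x = V *v (\<chi> i. a i * (W *v x) $ i)"
  using A_eigen[of "W *v x"] by simp

lemma linear_A: "linear A"
proof -
  have "A = (\<lambda>x. V *v (\<chi> i. a i * (W *v x) $ i))" using A_eq by auto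
  moreover have "linear (\<lambda>x. \<chi> i. a i * (W *v x) $ i)"
    by (simp add: linear_iff vec_eq_iff matrix_vector_right_distrib matrix_vector_mult_scaleR
        distrib_left)
  from linear_compose[OF this matrix_vector_mul_linear[of V]]
  have "linear (\<lambda>x. V *v (\<chi> i. a i * (W *v x) $ i))"
    by (simp add: o_def)
  ultimately show ?thesis by simp
qed

lemma A_power: "(A ^^ k) (V *v y) = V *v (\<chi> i. a i ^ k * y $ i)"
  by (induction k) (simp_all add: A_eigen mult.assoc)

lemma V_mult: "V *v y = (\<Sum>i\<in>UNIV. y $ i *\<^sub>R column i V)"
  by (simp add: matrix_mult_sum scalar_mult_eq_scaleR)

lemma flow_expand: "flow s x = (\<Sum>i\<in>UNIV. (exp (s * a i) * (W *v x) $ i) *\<^sub>R column i V)"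
  unfolding flow_def V_mult by simp

text \<open>
  The defining series depends on \<open>r\<close> only through \<open>ln r\<close>, so the identity also covers the scale
  \<open>1 / N 0 = 0\<close> that occurs in the radial derivative at the origin.
\<close>

lemma dilation_eq_flow: "dilation A r x = flow (ln r) x"
proof -
  define y where "y = W *v x"
  have x: "x = V *v y" by (simp add: y_def)
  have "(\<lambda>k. \<Sum>i\<in>UNIV. ((ln r * a i) ^ k /\<^sub>R fact k * y $ i) *\<^sub>R column i V) sums flow (ln r) x"
    unfolding flow_expand y_def
    by (intro sums_sum sums_scaleR_left sums_mult2 exp_converges)
  moreover have "(\<Sum>i\<in>UNIV. ((ln r * a i) ^ k /\<^sub>R fact k * y $ i) *\<^sub>R column i V)
      = (ln r ^ k / fact k) *\<^sub>R (A ^^ k) x" for k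
    unfolding x unfolding A_power unfolding V_mult
    by (simp add: scaleR_sum_right power_mult_distrib divide_inverse mult_ac)
  ultimately show ?thesis by (simp add: dilation_def sums_iff)
qed

lemma flow_flow: "flow s (flow t x) = flow (s + t) x"
  by (simp add: flow_def distrib_right exp_add mult.assoc)

lemma flow_0 [simp]: "flow 0 x = x"
  by (simp add: flow_def)

lemma flow_zero [simp]: "flow s 0 = 0"
  by (simp add: flow_expand)

lemma flow_has_vector_derivative:
  "((\<lambda>s. flow s x) has_vector_derivative A (flow s x)) (at s)"
proof -
  have "A (flow s x) = (\<Sum>i\<in>UNIV. (exp (s * a i) * a i * (W *v x) $ i) *\<^sub>R column i V)"
    unfolding flow_def unfolding A_eigen unfolding V_mult by (simp add: mult_ac)
  moreover have "((\<lambda>s. (exp (s * a i) * (W *v x) $ i) *\<^sub>R column i V) has_vector_derivative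
      (exp (s * a i) * a i * (W *v x) $ i) *\<^sub>R column i V) (at s)" for i
  proof -
    have "((\<lambda>s. exp (s * a i) * (W *v x) $ i) has_real_derivative exp (s * a i) * a i * (W *v x) $ i) (at s)"
      by (auto intro!: derivative_eq_intros)
    from has_vector_derivative_scaleR[OF this has_vector_derivative_const] show ?thesis by simp
  qed
  ultimately show ?thesis
    unfolding flow_expand by (auto intro!: has_vector_derivative_sum)
qed

lemma continuous_on_flow: "continuous_on S (\<lambda>s. flow s x)"
  unfolding flow_expand by (intro continuous_intros)

lemma flow_tendsto_0: "((\<lambda>s. flow s x) \<longlongrightarrow> 0) at_bot"
proof -
  have "((\<lambda>s. exp (s * a i)) \<longlongrightarrow> 0) at_bot" for i
  proof (rule filterlim_compose[OF exp_at_bot])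
    show "filterlim (\<lambda>s. s * a i) at_bot at_bot"
      using a_pos[of i] filterlim_tendsto_pos_mult_at_bot[OF tendsto_const[of "a i"], of "\<lambda>s. s" at_bot]
      by (simp add: mult.commute filterlim_ident)
  qed
  then have "((\<lambda>s. flow s x) \<longlongrightarrow> (\<Sum>i\<in>UNIV. (0 * (W *v x) $ i) *\<^sub>R column i V)) at_bot"
    unfolding flow_expand by (intro tendsto_intros)
  then show ?thesis by simp
qed

lemma measurable_flow [measurable (raw)]:
  assumes f[measurable]: "f \<in> borel_measurable M" and g[measurable]: "g \<in> M \<rightarrow>\<^sub>M borel"
  shows "(\<lambda>x. flow (f x) (g x)) \<in> M \<rightarrow>\<^sub>M borel"
proof -
  have "continuous_on UNIV (\<lambda>y. (W *v y) $ i)" for i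
    by (intro continuous_intros)
  then have [measurable]: "(\<lambda>y. (W *v y) $ i) \<in> borel_measurable borel" for i
    by (rule borel_measurable_continuous_onI)
  show ?thesis unfolding flow_expand by measurable
qed

lemma homogeneous_dimension_eq: "homogeneous_dimension A = (\<Sum>i\<in>UNIV. a i)"
proof -
  define L :: "real ^ 'n ^ 'n" where "L = (\<chi> i j. if i = j then a i else 0)"
  have L: "L *v y = (\<chi> i. a i * y $ i)" for y
    by (simp add: L_def matrix_vector_mult_def if_distrib[of "\<lambda>c. c * _"] cong: if_cong)
  have "A = (\<lambda>x. (V ** L ** W) *v x)"
    using A_eq by (simp only: fun_eq_iff L matrix_vector_mul_assoc[symmetric] simp_thms)
  then have "matrix A = V ** L ** W" by (simp only: matrix_of_matrix_vector_mul)
  then have "trace (matrix A) = trace (W ** (V ** L))" by (simp only: trace_mul_sym[of "V ** L" W])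
  also have "\<dots> = trace L" by (simp only: matrix_mul_assoc WV matrix_mul_lid)
  finally show ?thesis by (simp add: homogeneous_dimension_def trace_def L_def)
qed

text \<open>
  The changes of basis by \<open>V\<close> and \<open>W\<close> contribute mutually inverse constants, so only the Jacobian
  of the diagonal part remains.
\<close>

lemma nn_integral_flow:
  assumes F[measurable]: "F \<in> borel_measurable borel"
  shows "ennreal (exp (s * homogeneous_dimension A)) * (\<integral>\<^sup>+x. F (flow s x) \<partial>lborel) = (\<integral>\<^sup>+x. F x \<partial>lborel)"
proof -
  define L :: "real ^ 'n \<Rightarrow> real ^ 'n" where "L y = (\<chi> i. exp (s * a i) * y $ i)" for y
  define v :: "real ^ 'n" where "v = (\<chi> i. a i)"
  have L_sum: "L = (\<lambda>y. 0 + (\<Sum>j\<in>Basis. (exp (s * (v \<bullet> j)) * (y \<bullet> j)) *\<^sub>R j))"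
  proof (rule ext, rule euclidean_eqI)
    fix y b :: "real ^ 'n" assume b: "b \<in> Basis"
    then obtain i where "b = axis i 1" by (auto simp: Basis_vec_def)
    then have "L y \<bullet> b = exp (s * (v \<bullet> b)) * (y \<bullet> b)"
      by (simp add: L_def v_def inner_axis)
    with b show "L y \<bullet> b = (0 + (\<Sum>j\<in>Basis. (exp (s * (v \<bullet> j)) * (y \<bullet> j)) *\<^sub>R j)) \<bullet> b"
      by simp
  qed
  have dim: "(\<Sum>j\<in>Basis. v \<bullet> j) = homogeneous_dimension A"
  proof -
    have "(\<Sum>j\<in>Basis. v \<bullet> j) = (\<Sum>i\<in>UNIV. v \<bullet> axis i 1)"
    proof -
      have "(Basis :: (real ^ 'n) set) = range (\<lambda>i. axis i 1)" by (auto simp: Basis_vec_def)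
      moreover have "inj (\<lambda>i. axis i (1::real) :: real ^ 'n)" by (auto simp: inj_def axis_eq_axis)
      ultimately show ?thesis
        using sum.reindex[of "\<lambda>i. axis i 1" UNIV "\<lambda>j. v \<bullet> j"] by (simp add: o_def)
    qed
    then show ?thesis by (simp add: v_def inner_axis homogeneous_dimension_eq)
  qed
  have [measurable]: "L \<in> borel \<rightarrow>\<^sub>M borel" unfolding L_sum by measurable
  have [measurable]: "(\<lambda>x. V *v x) \<in> borel \<rightarrow>\<^sub>M borel" "(\<lambda>x. W *v x) \<in> borel \<rightarrow>\<^sub>M borel"
    by (auto intro!: borel_measurable_continuous_onI continuous_intros)
  have scale: "ennreal (exp (s * homogeneous_dimension A)) * (\<integral>\<^sup>+x. H (L x) \<partial>lborel) = (\<integral>\<^sup>+x. H x \<partial>lborel)"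
    if H[measurable]: "H \<in> borel_measurable borel" for H :: "real ^ 'n \<Rightarrow> ennreal"
  proof -
    have "lborel = density (distr lborel borel L) (\<lambda>_. ennreal (\<Prod>j\<in>Basis. \<bar>exp (s * (v \<bullet> j))\<bar>))"
      unfolding L_sum by (rule lborel_affine_euclidean) simp
    then have "(\<integral>\<^sup>+x. H x \<partial>lborel)
        = (\<integral>\<^sup>+x. H x \<partial>density (distr lborel borel L) (\<lambda>_. ennreal (\<Prod>j\<in>Basis. \<bar>exp (s * (v \<bullet> j))\<bar>)))"
      by (rule arg_cong[of _ _ "\<lambda>M. integral\<^sup>N M H"])
    also have "(\<Prod>j\<in>Basis. \<bar>exp (s * (v \<bullet> j))\<bar>) = exp (s * homogeneous_dimension A)"
      by (simp add: exp_sum sum_distrib_left flip: dim)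
    finally show ?thesis by (simp add: nn_integral_density nn_integral_distr nn_integral_cmult)
  qed
  obtain c where c: "\<And>F. F \<in> borel_measurable borel \<Longrightarrow>
      (\<integral>\<^sup>+x. F (W *v x) \<partial>lborel) = c * (\<integral>\<^sup>+x. F x \<partial>lborel)"
    using linear_change_of_variables[of "(*v) W" "(*v) V"] by auto
  have "(\<integral>\<^sup>+x. F (flow s x) \<partial>lborel) = (\<integral>\<^sup>+x. F (V *v L (W *v x)) \<partial>lborel)"
    by (simp add: flow_def L_def)
  also have "\<dots> = c * (\<integral>\<^sup>+x. F (V *v L x) \<partial>lborel)"
    by (rule c) measurable
  finally have "ennreal (exp (s * homogeneous_dimension A)) * (\<integral>\<^sup>+x. F (flow s x) \<partial>lborel)
      = c * (\<integral>\<^sup>+x. F (V *v x) \<partial>lborel)"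
    using scale[of "\<lambda>x. F (V *v x)"] by (simp add: mult.left_commute)
  also have "\<dots> = (\<integral>\<^sup>+x. F (V *v (W *v x)) \<partial>lborel)"
    by (rule c[symmetric]) measurable
  finally show ?thesis by simp
qed

end

section \<open>Polar coordinates\<close>

lemma nn_integral_exp_atMost_finite:
  fixes c b :: real
  assumes "0 < c"
  shows "(\<integral>\<^sup>+s. ennreal (exp (c * s)) * indicator {..b} s \<partial>lborel) < \<infinity>"
proof -
  have "((\<lambda>t. exp (- c * t)) \<longlongrightarrow> 0) at_top"
    using assms
    by (intro filterlim_compose[OF exp_at_bot] filterlim_tendsto_neg_mult_at_bot[OF tendsto_const])
      (auto intro: filterlim_ident)
  then have lim: "((\<lambda>t. - exp (- c * t) / c) \<longlongrightarrow> - 0 / c) at_top"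
    using assms by (intro tendsto_intros) auto
  have "(\<integral>\<^sup>+s. ennreal (exp (c * s)) * indicator {..b} s \<partial>lborel)
      = (\<integral>\<^sup>+t. ennreal (exp (- c * t)) * indicator {- b..} t \<partial>lborel)"
    by (subst nn_integral_real_affine[where c = "-1" and t = 0])
      (auto intro!: nn_integral_cong simp: indicator_def)
  also have "\<dots> = ennreal (- 0 / c - (- exp (- c * (- b)) / c))"
    using assms by (intro nn_integral_FTC_atLeast lim) (auto intro!: derivative_eq_intros)
  finally show ?thesis by simp
qed

locale homogeneous_norm = diagonal_form A V W a
  for A :: "real ^ 'n \<Rightarrow> real ^ 'n" and V W :: "real ^ 'n ^ 'n" and a :: "'n \<Rightarrow> real" +
  fixes N :: "real ^ 'n \<Rightarrow> real"
  assumes continuous_N: "continuous_on UNIV N"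
    and N_nonneg: "0 \<le> N x"
    and N_flow: "N (flow s x) = exp s * N x"
    and N_eq_0: "N x = 0 \<longleftrightarrow> x = 0"
begin

abbreviation D :: real where "D \<equiv> homogeneous_dimension A"

lemma N_pos: "x \<noteq> 0 \<Longrightarrow> 0 < N x"
  using N_nonneg[of x] N_eq_0[of x] by linarith

lemma measurable_N [measurable]: "N \<in> borel_measurable borel"
  by (intro borel_measurable_continuous_onI continuous_N)

definition shell :: "real \<Rightarrow> (real ^ 'n) set" where
  "shell \<rho> = {z. \<rho> \<le> N z \<and> N z < \<rho> * exp 1}"

lemma measurable_shell [measurable]: "shell \<rho> \<in> sets borel"
  unfolding shell_def by measurable

definition orbit_integral :: "(real ^ 'n \<Rightarrow> ennreal) \<Rightarrow> real ^ 'n \<Rightarrow> ennreal" where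
  "orbit_integral F z = (\<integral>\<^sup>+s. ennreal (exp (D * s)) * F (flow s z) \<partial>lborel)"

lemma measurable_orbit_integral [measurable]:
  assumes [measurable]: "F \<in> borel_measurable borel"
  shows "orbit_integral F \<in> borel_measurable borel"
proof -
  have "(\<lambda>z. \<integral>\<^sup>+s. ennreal (exp (D * s)) * F (flow s z) \<partial>lborel) \<in> borel_measurable borel"
    by measurable
  then show ?thesis by (simp add: orbit_integral_def[abs_def])
qed

text \<open>
  The orbit of \<open>x \<noteq> 0\<close> meets the shell in a parameter interval of length 1 (fact \<open>len\<close>). Inserting
  this as a factor 1 into the integral of \<open>F\<close>, exchanging the order of integration and substituting
  \<open>x = flow s z\<close> gives polar coordinates with the shell in the role of the sphere.
\<close>

lemma nn_integral_polar:
  assumes \<rho>: "0 < \<rho>" and F[measurable]: "F \<in> borel_measurable borel"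
  shows "(\<integral>\<^sup>+x. F x \<partial>lborel) = (\<integral>\<^sup>+z\<in>shell \<rho>. orbit_integral F z \<partial>lborel)"
proof -
  have len: "(\<integral>\<^sup>+s. indicator (shell \<rho>) (flow (- s) x) \<partial>lborel) = 1" if "x \<noteq> 0" for x
  proof -
    define b where "b = ln (N x / \<rho>)"
    have "N x = \<rho> * exp b" using N_pos[OF that] \<rho> by (simp add: b_def)
    then have "indicator (shell \<rho>) (flow (- s) x) = (indicator {b - 1<..b} s :: ennreal)" for s
      using \<rho> by (auto simp: shell_def N_flow indicator_def mult_ac simp flip: exp_add)
    then show ?thesis by simp
  qed
  have "(\<integral>\<^sup>+z\<in>shell \<rho>. orbit_integral F z \<partial>lborel)
      = (\<integral>\<^sup>+z. (\<integral>\<^sup>+s. ennreal (exp (D * s)) * (F (flow s z) * indicator (shell \<rho>) z) \<partial>lborel) \<partial>lborel)"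
    unfolding orbit_integral_def
    by (intro nn_integral_cong) (simp add: nn_integral_multc[symmetric] mult.assoc)
  also have "\<dots> = (\<integral>\<^sup>+s. (\<integral>\<^sup>+z. ennreal (exp (D * s)) * (F (flow s z) * indicator (shell \<rho>) z) \<partial>lborel) \<partial>lborel)"
    by (rule lborel_pair.Fubini') measurable
  also have "\<dots> = (\<integral>\<^sup>+s. (\<integral>\<^sup>+x. F x * indicator (shell \<rho>) (flow (- s) x) \<partial>lborel) \<partial>lborel)"
  proof (rule nn_integral_cong)
    fix s
    have "(\<integral>\<^sup>+z. ennreal (exp (D * s)) * (F (flow s z) * indicator (shell \<rho>) z) \<partial>lborel)
        = ennreal (exp (s * D)) * (\<integral>\<^sup>+z. F (flow s z) * indicator (shell \<rho>) (flow (- s) (flow s z)) \<partial>lborel)"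
      by (simp add: flow_flow nn_integral_cmult mult.commute)
    also have "\<dots> = (\<integral>\<^sup>+x. F x * indicator (shell \<rho>) (flow (- s) x) \<partial>lborel)"
      by (rule nn_integral_flow) measurable
    finally show "(\<integral>\<^sup>+z. ennreal (exp (D * s)) * (F (flow s z) * indicator (shell \<rho>) z) \<partial>lborel)
        = (\<integral>\<^sup>+x. F x * indicator (shell \<rho>) (flow (- s) x) \<partial>lborel)" .
  qed
  also have "\<dots> = (\<integral>\<^sup>+x. (\<integral>\<^sup>+s. F x * indicator (shell \<rho>) (flow (- s) x) \<partial>lborel) \<partial>lborel)"
    by (rule lborel_pair.Fubini') measurable
  also have "\<dots> = (\<integral>\<^sup>+x. F x \<partial>lborel)"
  proof (rule nn_integral_cong_AE, use AE_lborel_singleton[of "0 :: real ^ 'n"] in eventually_elim)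
    fix x :: "real ^ 'n" assume "x \<noteq> 0"
    moreover have "(\<integral>\<^sup>+s. F x * indicator (shell \<rho>) (flow (- s) x) \<partial>lborel)
        = F x * (\<integral>\<^sup>+s. indicator (shell \<rho>) (flow (- s) x) \<partial>lborel)"
      by (rule nn_integral_cmult) measurable
    ultimately show "(\<integral>\<^sup>+s. F x * indicator (shell \<rho>) (flow (- s) x) \<partial>lborel) = F x"
      by (simp add: len)
  qed
  finally show ?thesis ..
qed

lemma nn_integral_le_orbitwise:
  assumes [measurable]: "F \<in> borel_measurable borel" "G \<in> borel_measurable borel"
      "H \<in> borel_measurable borel"
    and le: "\<And>z. z \<noteq> 0 \<Longrightarrow> b * orbit_integral F z + c * orbit_integral G z \<le> orbit_integral H z"
  shows "b * (\<integral>\<^sup>+x. F x \<partial>lborel) + c * (\<integral>\<^sup>+x. G x \<partial>lborel) \<le> (\<integral>\<^sup>+x. H x \<partial>lborel)"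
proof -
  have "b * (\<integral>\<^sup>+x. F x \<partial>lborel) + c * (\<integral>\<^sup>+x. G x \<partial>lborel)
      = (\<integral>\<^sup>+z. b * (orbit_integral F z * indicator (shell 1) z)
          + c * (orbit_integral G z * indicator (shell 1) z) \<partial>lborel)"
    by (simp add: nn_integral_polar[of 1 F] nn_integral_polar[of 1 G] nn_integral_cmult nn_integral_add)
  also have "\<dots> \<le> (\<integral>\<^sup>+z\<in>shell 1. orbit_integral H z \<partial>lborel)"
  proof (rule nn_integral_mono)
    fix z
    have "z \<noteq> 0" if "z \<in> shell 1" using that N_eq_0[of 0] by (auto simp: shell_def)
    then show "b * (orbit_integral F z * indicator (shell 1) z)
        + c * (orbit_integral G z * indicator (shell 1) z) \<le> orbit_integral H z * indicator (shell 1) z"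
      using le[of z] by (cases "z \<in> shell 1") auto
  qed
  also have "\<dots> = (\<integral>\<^sup>+x. H x \<partial>lborel)"
    by (simp add: nn_integral_polar[of 1 H])
  finally show ?thesis .
qed

text \<open>
  A point outside the unit ball is carried by a contracting dilation to the unit sphere, where
  \<open>N\<close> has a positive minimum.
\<close>

lemma small_N_in_ball: "\<exists>m>0. \<forall>x. N x < m \<longrightarrow> norm x < 1"
proof -
  have "\<exists>x\<in>sphere (0 :: real ^ 'n) 1. \<forall>y\<in>sphere 0 1. N x \<le> N y"
    using continuous_on_subset[OF continuous_N]
    by (intro continuous_attains_inf compact_sphere) auto
  then obtain x0 where x0: "norm x0 = 1" and min: "\<And>y. norm y = 1 \<Longrightarrow> N x0 \<le> N y"
    by auto
  have "norm x < 1" if "N x < N x0" for x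
  proof (rule ccontr)
    assume "\<not> norm x < 1"
    have "((\<lambda>s. norm (flow s x)) \<longlongrightarrow> 0) at_bot"
      using tendsto_norm[OF flow_tendsto_0[of x]] by simp
    then have "\<forall>\<^sub>F s in at_bot. norm (flow s x) < 1"
      by (rule order_tendstoD) simp
    then obtain t where t: "\<And>s. s \<le> t \<Longrightarrow> norm (flow s x) < 1"
      by (auto simp: eventually_at_bot_linorder)
    have "\<exists>s. min t 0 \<le> s \<and> s \<le> 0 \<and> norm (flow s x) = 1"
      using t[of "min t 0"] \<open>\<not> norm x < 1\<close>
      by (intro IVT') (auto intro!: continuous_on_norm continuous_on_flow)
    then obtain s where s: "s \<le> 0" "norm (flow s x) = 1" by auto
    have "N x0 \<le> exp s * N x" using min[OF s(2)] by (simp add: N_flow)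
    also have "\<dots> \<le> N x" using s(1) N_nonneg by (simp add: mult_left_le_one_le)
    finally show False using that by simp
  qed
  moreover have "0 < N x0" using x0 by (intro N_pos) auto
  ultimately show ?thesis by blast
qed

text \<open>
  In polar coordinates the integrand is \<open>exp ((D - p) * s)\<close> up to a factor bounded on the shell, and
  \<open>s\<close> is bounded above. The value \<open>\<rho> = m / e\<close> places the shell inside the unit ball, so that its
  volume is finite.
\<close>

lemma nn_integral_N_powr_finite:
  assumes "p < D" "0 \<le> p"
  shows "(\<integral>\<^sup>+x. ennreal (1 / N x powr p) * indicator {x. N x \<le> B} x \<partial>lborel) < \<infinity>"
proof -
  obtain m where m: "0 < m" "\<And>x. N x < m \<Longrightarrow> norm x < 1" using small_N_in_ball by auto
  define \<rho> where "\<rho> = m / exp 1"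
  have \<rho>: "0 < \<rho>" "\<rho> * exp 1 = m" using m by (auto simp: \<rho>_def)
  \<comment> \<open>a positive bound, so that its logarithm is meaningful\<close>
  define C where "C = max B 1"
  define b where "b = ln (C / \<rho>)"
  have "shell \<rho> \<subseteq> ball 0 1" using m by (auto simp: shell_def \<rho>(2))
  then have fin: "emeasure lborel (shell \<rho>) < \<infinity>"
    using emeasure_mono[of "shell \<rho>" "ball 0 1" lborel] emeasure_lborel_ball_finite[of 0 1]
    by (auto intro: order_le_less_trans)
  have bound: "ennreal (exp (D * s)) * (ennreal (1 / N (flow s z) powr p) * indicator {x. N x \<le> B} (flow s z))
      \<le> ennreal (1 / \<rho> powr p) * (ennreal (exp ((D - p) * s)) * indicator {..b} s)"
    if z: "z \<in> shell \<rho>" for z s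
  proof (cases "exp s * N z \<le> B")
    case True
    have Nz: "\<rho> \<le> N z" using z by (simp add: shell_def)
    have "exp s * \<rho> \<le> C"
      using mult_left_mono[OF Nz exp_ge_zero[of s]] True unfolding C_def by linarith
    then have "s \<le> b"
      using \<rho>(1) by (simp add: b_def C_def ln_ge_iff pos_le_divide_eq)
    moreover have "exp (D * s) * (1 / (exp s * N z) powr p) \<le> 1 / \<rho> powr p * exp ((D - p) * s)"
    proof -
      have "exp (D * s) * (1 / (exp s * N z) powr p) = 1 / N z powr p * exp ((D - p) * s)"
      proof -
        have "exp ((D - p) * s) = exp (D * s) / exp (s * p)"
          by (simp add: algebra_simps flip: exp_diff)
        then show ?thesis using N_nonneg[of z] by (simp add: powr_mult exp_powr_real)
      qed
      also have "\<dots> \<le> 1 / \<rho> powr p * exp ((D - p) * s)"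
        using Nz \<rho>(1) assms by (intro mult_right_mono divide_left_mono powr_mono2 mult_pos_pos) auto
      finally show ?thesis .
    qed
    ultimately show ?thesis
      using True by (simp add: N_flow flip: ennreal_mult)
  qed (simp add: N_flow)
  have "(\<integral>\<^sup>+x. ennreal (1 / N x powr p) * indicator {x. N x \<le> B} x \<partial>lborel)
      = (\<integral>\<^sup>+z\<in>shell \<rho>. orbit_integral (\<lambda>x. ennreal (1 / N x powr p) * indicator {x. N x \<le> B} x) z \<partial>lborel)"
    using \<rho>(1) by (intro nn_integral_polar) measurable
  also have "\<dots> \<le> (\<integral>\<^sup>+z\<in>shell \<rho>. ennreal (1 / \<rho> powr p)
      * (\<integral>\<^sup>+s. ennreal (exp ((D - p) * s)) * indicator {..b} s \<partial>lborel) \<partial>lborel)"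
  proof (rule nn_integral_mono)
    fix z
    have "orbit_integral (\<lambda>x. ennreal (1 / N x powr p) * indicator {x. N x \<le> B} x) z
      \<le> (\<integral>\<^sup>+s. ennreal (1 / \<rho> powr p) * (ennreal (exp ((D - p) * s)) * indicator {..b} s) \<partial>lborel)"
      if "z \<in> shell \<rho>"
      unfolding orbit_integral_def by (intro nn_integral_mono bound that)
    then show "orbit_integral (\<lambda>x. ennreal (1 / N x powr p) * indicator {x. N x \<le> B} x) z * indicator (shell \<rho>) z
      \<le> ennreal (1 / \<rho> powr p)
      * (\<integral>\<^sup>+s. ennreal (exp ((D - p) * s)) * indicator {..b} s \<partial>lborel) * indicator (shell \<rho>) z"
      by (cases "z \<in> shell \<rho>") (simp_all add: nn_integral_cmult)
  qed
  also have "\<dots> = ennreal (1 / \<rho> powr p)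
      * (\<integral>\<^sup>+s. ennreal (exp ((D - p) * s)) * indicator {..b} s \<partial>lborel) * emeasure lborel (shell \<rho>)"
    by (simp add: nn_integral_cmult_indicator)
  also have "\<dots> < \<infinity>"
    using fin nn_integral_exp_atMost_finite[of "D - p" b] assms
    by (auto simp: ennreal_mult_less_top)
  finally show ?thesis .
qed

end

section \<open>Test functions along the orbits of the dilations\<close>

lemma frechet_derivative_sum_Basis:
  fixes u :: "'a::euclidean_space \<Rightarrow> real"
  assumes "u differentiable (at x)"
  shows "frechet_derivative u (at x) v = (\<Sum>b\<in>Basis. (v \<bullet> b) * frechet_derivative u (at x) b)"
proof -
  have lin: "linear (frechet_derivative u (at x))"
    using assms by (rule linear_frechet_derivative)
  have "frechet_derivative u (at x) v = frechet_derivative u (at x) (\<Sum>b\<in>Basis. (v \<bullet> b) *\<^sub>R b)"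
    by (simp add: euclidean_representation)
  then show ?thesis by (simp add: linear_sum[OF lin] linear_scale[OF lin])
qed

text \<open>
  The Jacobian \<open>exp (D * s)\<close> splits into the power \<open>p\<close> of the dilation factor and the weight that
  turns \<open>u\<close> into \<open>w\<close>.
\<close>

lemma powr_exp_scale:
  fixes \<alpha> p D n s y :: real
  assumes "\<alpha> * p = D - p" "0 < n"
  shows "exp (D * s) * (\<bar>y\<bar> powr p / (exp s * n) powr p) = \<bar>exp (\<alpha> * s) * y\<bar> powr p / n powr p"
proof -
  have "D * s = p * s + s * (\<alpha> * p)" by (simp add: assms(1) algebra_simps)
  then have "exp (D * s) = exp (p * s) * exp (\<alpha> * s * p)" by (simp add: exp_add mult_ac)
  then show ?thesis
    using assms(2) by (simp add: powr_mult abs_mult exp_powr_real mult_ac)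
qed

context homogeneous_norm
begin

text \<open>
  The derivative of \<open>u\<close> along \<open>flow\<close>. For smooth \<open>u\<close> it is continuous also at the origin, where the
  radial derivative, which differs by the factor \<open>1 / N x\<close>, may be unbounded.
\<close>

definition euler_deriv :: "(real ^ 'n \<Rightarrow> real) \<Rightarrow> real ^ 'n \<Rightarrow> real" where
  "euler_deriv u x = frechet_derivative u (at x) (A x)"

lemma flow_has_real_derivative:
  assumes u: "\<And>x. u differentiable (at x)"
  shows "((\<lambda>s. u (flow s z)) has_real_derivative euler_deriv u (flow s z)) (at s)"
proof -
  have "(u has_derivative frechet_derivative u (at (flow s z))) (at (flow s z))"
    using u frechet_derivative_works by blast
  from has_derivative_compose[OF flow_has_vector_derivative[unfolded has_vector_derivative_def] this]
  have "((\<lambda>s. u (flow s z)) has_derivative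
      (\<lambda>h. frechet_derivative u (at (flow s z)) (h *\<^sub>R A (flow s z)))) (at s)" .
  then show ?thesis
    by (rule has_derivative_imp_has_field_derivative)
      (simp add: euler_deriv_def linear_scale[OF linear_frechet_derivative[OF u]])
qed

text \<open>
  At the origin both sides are 0: the curve is constant there, and the right-hand side is a
  quotient by 0.
\<close>

lemma radial_deriv_eq:
  assumes u: "\<And>x. u differentiable (at x)"
  shows "radial_deriv A N u x = euler_deriv u x / N x"
proof (cases "x = 0")
  case True
  then show ?thesis
    using N_eq_0[of x] by (simp add: radial_deriv_def dilation_eq_flow)
next
  case False
  have "((\<lambda>r. u (flow (ln r) (flow (ln (1 / N x)) x))) has_real_derivative
      euler_deriv u x / N x) (at (N x))"
  proof -
    define f where "f r = ln r + ln (1 / N x)" for r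
    have N: "0 < N x" using N_pos[OF False] .
    have "(f has_real_derivative 1 / N x) (at (N x))"
      unfolding f_def[abs_def] using N by (auto intro!: derivative_eq_intros)
    from DERIV_chain2[of "\<lambda>s. u (flow s x)" _ f, OF flow_has_real_derivative[OF u] this]
    show ?thesis using N by (simp add: flow_flow f_def ln_div)
  qed
  then show ?thesis
    by (simp add: radial_deriv_def dilation_eq_flow DERIV_imp_deriv)
qed

lemma test_function_regular:
  assumes u: "test_function u"
  shows "u differentiable (at x)" "continuous_on UNIV u" "continuous_on UNIV (euler_deriv u)"
proof -
  have "C_diff (Suc 0) u" using u by (simp only: test_function_def smooth_def)
  then have diff: "\<And>x. u differentiable (at x)"
    and cont: "\<And>v. continuous_on UNIV (\<lambda>x. frechet_derivative u (at x) v)" by auto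
  show "u differentiable (at x)" by (rule diff)
  show "continuous_on UNIV u"
    using diff by (intro continuous_at_imp_continuous_on) (auto intro: differentiable_imp_continuous_within)
  have "continuous_on UNIV A"
    using linear_A by (intro linear_continuous_on) (simp add: linear_conv_bounded_linear)
  then have "continuous_on UNIV (\<lambda>x. \<Sum>b\<in>Basis. (A x \<bullet> b) * frechet_derivative u (at x) b)"
    by (intro continuous_intros cont)
  moreover have "euler_deriv u = (\<lambda>x. \<Sum>b\<in>Basis. (A x \<bullet> b) * frechet_derivative u (at x) b)"
    unfolding euler_deriv_def by (rule ext, rule frechet_derivative_sum_Basis, rule diff)
  ultimately show "continuous_on UNIV (euler_deriv u)" by simp
qed

lemma test_function_bounds:
  assumes u: "test_function u"
  obtains B M where "\<And>x. u x \<noteq> 0 \<Longrightarrow> N x \<le> B" "\<And>x. euler_deriv u x \<noteq> 0 \<Longrightarrow> N x \<le> B"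
    "\<And>x. \<bar>euler_deriv u x\<bar> \<le> M" "0 \<le> M"
proof -
  define K where "K = closure {x. u x \<noteq> 0}"
  have K: "compact K" using u by (simp add: test_function_def K_def)
  have uK: "x \<in> K" if "u x \<noteq> 0" for x
    using that closure_subset[of "{x. u x \<noteq> 0}"] by (auto simp: K_def)
  have EK: "x \<in> K" if "euler_deriv u x \<noteq> 0" for x
  proof (rule ccontr)
    assume "x \<notin> K"
    have "((\<lambda>y. 0) has_derivative (\<lambda>h. 0)) (at x)" by simp
    then have "(u has_derivative (\<lambda>h. 0)) (at x)"
      by (rule has_derivative_transform_within_open[where s = "- K"])
        (use \<open>x \<notin> K\<close> uK in \<open>auto simp: K_def\<close>)
    then have "frechet_derivative u (at x) = (\<lambda>h. 0)" by (rule frechet_derivative_at[symmetric])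
    with that show False by (simp add: euler_deriv_def)
  qed
  have "bounded (N ` K)" "bounded (euler_deriv u ` K)"
    using K continuous_N test_function_regular(3)[OF u]
    by (auto intro!: compact_imp_bounded compact_continuous_image intro: continuous_on_subset)
  then obtain B M where B: "\<And>x. x \<in> K \<Longrightarrow> \<bar>N x\<bar> \<le> B" and M: "\<And>x. x \<in> K \<Longrightarrow> \<bar>euler_deriv u x\<bar> \<le> M"
    by (auto simp: bounded_iff)
  have "\<bar>euler_deriv u x\<bar> \<le> max M 0" for x
    using M[of x] EK[of x] by (cases "euler_deriv u x = 0") auto
  then show thesis
    using B uK EK by (intro that[of B "max M 0"]) fastforce+
qed

lemma measurable_test_function [measurable]:
  assumes u: "test_function u"
  shows "u \<in> borel_measurable borel" "euler_deriv u \<in> borel_measurable borel"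
  using test_function_regular[OF u] by (auto intro: borel_measurable_continuous_onI)

lemma radial_deriv_energy_finite:
  assumes u: "test_function u" and p: "0 \<le> p" "p < D"
  shows "(\<integral>\<^sup>+x. ennreal (\<bar>radial_deriv A N u x\<bar> powr p) \<partial>lborel) < \<infinity>"
proof -
  obtain B M where B: "\<And>x. euler_deriv u x \<noteq> 0 \<Longrightarrow> N x \<le> B"
    and M: "\<And>x. \<bar>euler_deriv u x\<bar> \<le> M" "0 \<le> M"
    using test_function_bounds[OF u] by metis
  have "(\<integral>\<^sup>+x. ennreal (\<bar>radial_deriv A N u x\<bar> powr p) \<partial>lborel)
      \<le> (\<integral>\<^sup>+x. ennreal (M powr p) * (ennreal (1 / N x powr p) * indicator {x. N x \<le> B} x) \<partial>lborel)"
  proof (rule nn_integral_mono)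
    fix x
    have "\<bar>euler_deriv u x\<bar> powr p * (1 / N x powr p) \<le> M powr p * (1 / N x powr p)"
      using M p by (intro mult_right_mono powr_mono2) auto
    then show "ennreal (\<bar>radial_deriv A N u x\<bar> powr p)
        \<le> ennreal (M powr p) * (ennreal (1 / N x powr p) * indicator {x. N x \<le> B} x)"
      using B[of x] N_nonneg[of x]
      by (cases "euler_deriv u x = 0")
        (auto simp: radial_deriv_eq[OF test_function_regular(1)[OF u]] powr_divide
          simp flip: ennreal_mult intro!: ennreal_leI)
  qed
  also have "\<dots> = ennreal (M powr p) * (\<integral>\<^sup>+x. ennreal (1 / N x powr p) * indicator {x. N x \<le> B} x \<partial>lborel)"
    by (rule nn_integral_cmult) measurable
  also have "\<dots> < \<infinity>"
    using nn_integral_N_powr_finite[OF p(2,1), of B] by (simp add: ennreal_mult_less_top)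
  finally show ?thesis .
qed

lemma measurable_d_H_integrand [measurable]:
  assumes [measurable]: "u \<in> borel_measurable borel"
  shows "d_H_integrand A N p u R \<in> borel_measurable borel"
  unfolding d_H_integrand_def[abs_def] Let_def dilation_eq_flow by measurable

text \<open>
  The substitution \<open>w s = exp (\<alpha> * s) * u (flow s z)\<close>. The orbit crosses the sphere of radius \<open>R\<close> at
  \<open>s0 = ln (R / N z)\<close>, which turns the comparison function in \<open>d_H\<close> into the constant \<open>w s0\<close>.
\<close>

lemma hardy_remainder_on_orbit:
  assumes u: "test_function u" and p: "2 \<le> p" "p < D" and R: "0 < R" and z: "z \<noteq> 0"
  shows "ennreal (((D - p) / p) powr p) * orbit_integral (\<lambda>x. \<bar>u x\<bar> powr p / N x powr p) z
      + ennreal (2 powr (1 - p) / hardy_const p) * orbit_integral (\<lambda>x. d_H_integrand A N p u R x) z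
      \<le> orbit_integral (\<lambda>x. \<bar>radial_deriv A N u x\<bar> powr p) z"
proof -
  define \<alpha> where "\<alpha> = (D - p) / p"
  have \<alpha>: "0 < \<alpha>" "\<alpha> * p = D - p" using p by (auto simp: \<alpha>_def)
  have Nz: "0 < N z" using N_pos[OF z] .
  define s0 where "s0 = ln (R / N z)"
  define w where "w s = exp (\<alpha> * s) * u (flow s z)" for s
  define w' where "w' s = \<alpha> * w s + exp (\<alpha> * s) * euler_deriv u (flow s z)" for s
  have w: "(w has_real_derivative w' s) (at s)" for s
  proof -
    have "((\<lambda>s. exp (\<alpha> * s)) has_real_derivative \<alpha> * exp (\<alpha> * s)) (at s)"
      by (auto intro!: derivative_eq_intros)
    from DERIV_mult[OF this flow_has_real_derivative[OF test_function_regular(1)[OF u], of z s]]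
    show ?thesis unfolding w_def[abs_def] w'_def by (rule DERIV_cong) (simp add: w_def mult_ac)
  qed
  have w': "continuous_on UNIV w'"
    unfolding w'_def w_def
    by (intro continuous_intros continuous_on_flow
        continuous_on_compose2[OF test_function_regular(2)[OF u]]
        continuous_on_compose2[OF test_function_regular(3)[OF u]]) auto
  obtain B where B: "\<And>x. u x \<noteq> 0 \<Longrightarrow> N x \<le> B"
    using test_function_bounds[OF u] by metis
  have zero: "w s = 0" if "ln (max B 1 / N z) < s" for s
  proof -
    have "max B 1 / N z < exp s"
      using exp_less_mono[OF that] Nz by simp
    then have "B < N (flow s z)" using Nz by (simp add: N_flow pos_divide_less_eq)
    then show ?thesis using B[of "flow s z"] by (auto simp: w_def)
  qed
  have [measurable]: "w \<in> borel_measurable borel" "w' \<in> borel_measurable borel"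
    using w w' by (auto intro!: borel_measurable_continuous_onI continuous_at_imp_continuous_on
        intro: DERIV_isCont)
  have orbit: "orbit_integral (\<lambda>x. ennreal (f x)) z = ennreal (1 / N z powr p) * (\<integral>\<^sup>+s. ennreal (g s) \<partial>lborel)"
    if [measurable]: "g \<in> borel_measurable borel"
      and f: "\<And>s. exp (D * s) * f (flow s z) = 1 / N z powr p * g s" and g: "\<And>s. 0 \<le> g s"
    for f :: "real ^ 'n \<Rightarrow> real" and g
  proof -
    have "orbit_integral (\<lambda>x. ennreal (f x)) z = (\<integral>\<^sup>+s. ennreal (1 / N z powr p) * ennreal (g s) \<partial>lborel)"
      unfolding orbit_integral_def
      by (intro nn_integral_cong) (simp add: f g flip: ennreal_mult'' ennreal_mult')
    then show ?thesis by (simp add: nn_integral_cmult)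
  qed
  have scale: "exp (D * s) * \<bar>y\<bar> powr p / N (flow s z) powr p = \<bar>exp (\<alpha> * s) * y\<bar> powr p / N z powr p" for s y
    using powr_exp_scale[OF \<alpha>(2) Nz] by (simp add: N_flow)
  have "orbit_integral (\<lambda>x. ennreal (\<bar>u x\<bar> powr p / N x powr p)) z
      = ennreal (1 / N z powr p) * (\<integral>\<^sup>+s. ennreal (\<bar>w s\<bar> powr p) \<partial>lborel)"
  proof (rule orbit)
    show "exp (D * s) * (\<bar>u (flow s z)\<bar> powr p / N (flow s z) powr p) = 1 / N z powr p * \<bar>w s\<bar> powr p" for s
      by (simp add: scale w_def)
  qed simp_all
  moreover have "orbit_integral (\<lambda>x. ennreal (\<bar>radial_deriv A N u x\<bar> powr p)) z
      = ennreal (1 / N z powr p) * (\<integral>\<^sup>+s. ennreal (\<bar>w' s - \<alpha> * w s\<bar> powr p) \<partial>lborel)"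
  proof (rule orbit)
    fix s
    have "\<bar>radial_deriv A N u (flow s z)\<bar> powr p
        = \<bar>euler_deriv u (flow s z)\<bar> powr p / N (flow s z) powr p"
      using N_nonneg by (simp add: radial_deriv_eq[OF test_function_regular(1)[OF u]] powr_divide)
    then show "exp (D * s) * \<bar>radial_deriv A N u (flow s z)\<bar> powr p
        = 1 / N z powr p * \<bar>w' s - \<alpha> * w s\<bar> powr p"
      by (simp add: scale w'_def)
  qed simp_all
  moreover have "orbit_integral (\<lambda>x. ennreal (d_H_integrand A N p u R x)) z
      = ennreal (1 / N z powr p) * (\<integral>\<^sup>+s. ennreal (\<bar>w s - w s0\<bar> powr p / \<bar>s - s0\<bar> powr p) \<partial>lborel)"
  proof (rule orbit)
    fix s
    have ln: "ln (R / N (flow s z)) = s0 - s"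
      using Nz R by (simp add: N_flow s0_def ln_div ln_mult)
    have "exp (\<alpha> * s) * (R powr \<alpha> * N (flow s z) powr (- \<alpha>)) = exp (\<alpha> * s0)"
      using Nz R by (simp add: powr_def N_flow s0_def ln_div ln_mult algebra_simps flip: exp_add)
    moreover have "exp (\<alpha> * s) * (R powr \<alpha> * u (flow s0 z) * N (flow s z) powr (- \<alpha>))
        = exp (\<alpha> * s) * (R powr \<alpha> * N (flow s z) powr (- \<alpha>)) * u (flow s0 z)"
      by (simp only: mult_ac)
    ultimately have y: "exp (\<alpha> * s) * (u (flow s z) - R powr \<alpha> * u (flow s0 z) * N (flow s z) powr (- \<alpha>))
        = w s - w s0" (is "_ * ?y = _")
      by (simp only: right_diff_distrib w_def)
    have "exp (D * s) * d_H_integrand A N p u R (flow s z)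
        = exp (D * s) * \<bar>?y\<bar> powr p / N (flow s z) powr p / \<bar>s - s0\<bar> powr p"
      by (simp add: d_H_integrand_def Let_def dilation_eq_flow flow_flow ln abs_minus_commute flip: \<alpha>_def)
    then show "exp (D * s) * d_H_integrand A N p u R (flow s z)
        = 1 / N z powr p * (\<bar>w s - w s0\<bar> powr p / \<bar>s - s0\<bar> powr p)"
      unfolding scale y by simp
  qed simp_all
  moreover have "ennreal (1 / N z powr p)
      * (ennreal (\<alpha> powr p) * (\<integral>\<^sup>+s. \<bar>w s\<bar> powr p \<partial>lborel)
        + ennreal (2 powr (1 - p) / hardy_const p) * (\<integral>\<^sup>+s. \<bar>w s - w s0\<bar> powr p / \<bar>s - s0\<bar> powr p \<partial>lborel))
      \<le> ennreal (1 / N z powr p) * (\<integral>\<^sup>+s. \<bar>w' s - \<alpha> * w s\<bar> powr p \<partial>lborel)"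
    by (intro mult_left_mono log_radial_hardy[OF p(1) \<alpha>(1) w w' zero]) auto
  ultimately show ?thesis
    by (simp add: distrib_left mult.left_commute flip: \<alpha>_def)
qed

lemma hardy_remainder_nn_integral:
  assumes u: "test_function u" and p: "2 \<le> p" "p < D" and R: "0 < R"
  shows "ennreal (((D - p) / p) powr p) * (\<integral>\<^sup>+x. \<bar>u x\<bar> powr p / N x powr p \<partial>lborel)
      + ennreal (2 powr (1 - p) / hardy_const p) * (\<integral>\<^sup>+x. d_H_integrand A N p u R x \<partial>lborel)
      \<le> (\<integral>\<^sup>+x. \<bar>radial_deriv A N u x\<bar> powr p \<partial>lborel)"
proof (rule nn_integral_le_orbitwise)
  note [measurable] = measurable_test_function[OF u]
  show "(\<lambda>x. ennreal (\<bar>radial_deriv A N u x\<bar> powr p)) \<in> borel_measurable borel"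
    unfolding radial_deriv_eq[OF test_function_regular(1)[OF u]] by measurable
  show "(\<lambda>x. ennreal (\<bar>u x\<bar> powr p / N x powr p)) \<in> borel_measurable borel" by measurable
  show "(\<lambda>x. ennreal (d_H_integrand A N p u R x)) \<in> borel_measurable borel" by measurable
qed (rule hardy_remainder_on_orbit[OF u p R])

end

section \<open>The Hardy inequality with remainder\<close>

theorem theorem3p1:
  fixes bracket gmul :: "real ^ 'n \<Rightarrow> real ^ 'n \<Rightarrow> real ^ 'n"
    and ginv A :: "real ^ 'n \<Rightarrow> real ^ 'n"
    and N :: "real ^ 'n \<Rightarrow> real"
    and p :: real
  assumes "homogeneous_group bracket gmul ginv A"
    and "homogeneous_quasi_norm ginv A N"
    and "2 \<le> p" and "p < homogeneous_dimension A"
  shows "\<exists>C>0. \<forall>u :: real ^ 'n \<Rightarrow> real. test_function u \<longrightarrow>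
    integrable lborel (\<lambda>x. \<bar>radial_deriv A N u x\<bar> powr p) \<and>
    integrable lborel (\<lambda>x. \<bar>u x\<bar> powr p / N x powr p) \<and>
    (\<forall>R>0. integrable lborel (d_H_integrand A N p u R)) \<and>
    bdd_above ((\<lambda>R. d_H A N p u R powr p) ` {0<..}) \<and>
    (LINT x|lborel. \<bar>radial_deriv A N u x\<bar> powr p)
      - ((homogeneous_dimension A - p) / p) powr p
          * (LINT x|lborel. \<bar>u x\<bar> powr p / N x powr p)
      \<ge> C * (SUP R\<in>{0<..}. d_H A N p u R powr p)"
proof -
  have "diagonalisable_positive A"
    using assms(1) by (rule homogeneous_group.diagonalisable_positive)
  then obtain V W a where diag: "diagonal_form A V W a"
    by (rule diagonalisable_positive_imp_diagonal_form)
  have "homogeneous_norm A V W a N"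
  proof (intro homogeneous_norm.intro homogeneous_norm_axioms.intro diag)
    fix s x
    have "N (dilation A (exp s) x) = exp s * N x"
      using assms(2) unfolding homogeneous_quasi_norm_def by (metis exp_gt_zero)
    then show "N (diagonal_form.flow V W a s x) = exp s * N x"
      by (simp add: diagonal_form.dilation_eq_flow[OF diag])
  qed (use assms(2) in \<open>auto simp: homogeneous_quasi_norm_def\<close>)
  then interpret homogeneous_norm A V W a N .
  define \<gamma> where "\<gamma> = ((D - p) / p) powr p"
  define C where "C = 2 powr (1 - p) / hardy_const p"
  have C: "0 < C" using assms(3) hardy_const_pos[of p] by (simp add: C_def)
  show ?thesis
  proof (intro exI[of _ C] conjI allI impI C)
    fix u :: "real ^ 'n \<Rightarrow> real" assume u: "test_function u"
    note [measurable] = measurable_test_function[OF u]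
    let ?r = "\<lambda>x. \<bar>radial_deriv A N u x\<bar> powr p" and ?h = "\<lambda>x. \<bar>u x\<bar> powr p / N x powr p"
      and ?d = "d_H_integrand A N p u"
    have meas [measurable]: "?r \<in> borel_measurable borel"
      unfolding radial_deriv_eq[OF test_function_regular(1)[OF u]] by measurable
    have d_nonneg: "0 \<le> ?d R x" for R x
      by (simp add: d_H_integrand_def Let_def)
    have le: "ennreal \<gamma> * (\<integral>\<^sup>+x. ?h x \<partial>lborel) + ennreal C * (\<integral>\<^sup>+x. ?d R x \<partial>lborel)
        \<le> (\<integral>\<^sup>+x. ?r x \<partial>lborel)" if "0 < R" for R
      using hardy_remainder_nn_integral[OF u assms(3,4) that] by (simp add: \<gamma>_def C_def)
    have fin: "(\<integral>\<^sup>+x. ?r x \<partial>lborel) < \<infinity>"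
      using assms by (intro radial_deriv_energy_finite u) auto
    have \<gamma>: "0 < \<gamma>" using assms by (simp add: \<gamma>_def)
    have finite_terms: "(\<integral>\<^sup>+x. ?h x \<partial>lborel) < \<infinity>" "(\<integral>\<^sup>+x. ?d R x \<partial>lborel) < \<infinity>" if "0 < R" for R
      using le_less_trans[OF le[OF that] fin] C \<gamma> by (auto simp: ennreal_mult_less_top)
    show int_r: "integrable lborel ?r" using fin by (intro integrableI_nonneg) auto
    show int_h: "integrable lborel ?h"
      using finite_terms(1)[of 1] by (intro integrableI_nonneg) auto
    show int_d: "integrable lborel (?d R)" if "0 < R" for R
      using finite_terms(2)[OF that] d_nonneg by (intro integrableI_nonneg) auto
    have dH: "d_H A N p u R powr p = (LINT x|lborel. ?d R x)" for R
      using assms(3) Bochner_Integration.integral_nonneg[of lborel "?d R"] d_nonneg by (simp add: d_H_def powr_powr)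
    have bound: "d_H A N p u R powr p \<le> ((LINT x|lborel. ?r x) - \<gamma> * (LINT x|lborel. ?h x)) / C"
      if "0 < R" for R
    proof -
      have "ennreal (\<gamma> * (LINT x|lborel. ?h x) + C * (LINT x|lborel. ?d R x))
          \<le> ennreal (LINT x|lborel. ?r x)"
        using le[OF that] C \<gamma> d_nonneg
        by (simp add: nn_integral_eq_integral int_r int_h int_d[OF that] ennreal_mult ennreal_plus)
      then have "\<gamma> * (LINT x|lborel. ?h x) + C * (LINT x|lborel. ?d R x) \<le> (LINT x|lborel. ?r x)"
        by (simp add: ennreal_le_iff)
      then show ?thesis using C by (simp add: dH pos_le_divide_eq mult.commute)
    qed
    then show "bdd_above ((\<lambda>R. d_H A N p u R powr p) ` {0<..})"
      by (auto intro!: bdd_aboveI2)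
    have "(SUP R\<in>{0<..}. d_H A N p u R powr p)
        \<le> ((LINT x|lborel. ?r x) - \<gamma> * (LINT x|lborel. ?h x)) / C"
      using bound by (intro cSUP_least) auto
    then show "C * (SUP R\<in>{0<..}. d_H A N p u R powr p)
        \<le> (LINT x|lborel. ?r x) - ((D - p) / p) powr p * (LINT x|lborel. ?h x)"
      using C by (simp add: pos_le_divide_eq mult.commute flip: \<gamma>_def)
  qed
qed

end
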